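(* Let $5\le N\le 8$, let $B$ be the unit ball of $\mathbb{R}^N$, and let $\beta>0$, $\tau>0$. Then the extremal solution $u^*$ of the problem $$\beta\Delta^2u-\tau\Delta u=\frac{\lambda}{(1-u)^2}\ \text{ in }B,\qquad 0<u\le 1\ \text{ in }B,\qquad u=\Delta u=0\ \text{ on }\partial B \qquad (P_\lambda)$$ is regular, i.e. $\sup_B u^*<1$.
   Context: A classical solution of $(P_\lambda)$ ($\lambda>0$) is a function $u\in C^4(\overline B)$ with $\sup_B u<1$ satisfying the equation, the inequality $u>0$ in $B$ and the boundary conditions pointwise. Set $\lambda^*:=\sup\{\lambda>0:(P_\lambda)\text{ has a classical solution}\}$. It is known that $0<\lambda^*<\infty$, that for every $\lambda\in(0,\lambda^* )$ there is a minimal classical solution $u_\lambda$ (i.e. $u_\lambda\le v$ for every classical solution $v$ of $(P_\lambda)$), and that $\lambda\mapsto u_\lambda(x)$ is increasing for each $x\in B$. The extremal solution is $u^*(x):=\lim_{\lambda\nearrow\lambda^*}u_\lambda(x)$; $u^*$ is called regular if $\sup_Bu^*<1$ and singular if $\sup_Bu^*=1$. *)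

theory Defs
  imports "HOL-Analysis.Analysis"
begin

definition partial_deriv :: "'n::finite \<Rightarrow> (real^'n \<Rightarrow> real) \<Rightarrow> real^'n \<Rightarrow> real" where
  "partial_deriv i f x = frechet_derivative f (at x) (axis i 1)"

definition laplacian :: "(real^'n::finite \<Rightarrow> real) \<Rightarrow> real^'n \<Rightarrow> real" where
  "laplacian f x = (\<Sum>i\<in>UNIV. partial_deriv i (partial_deriv i f) x)"

definition extends_to_closure :: "(real^'n::finite) set \<Rightarrow> (real^'n \<Rightarrow> real) \<Rightarrow> bool" where
  "extends_to_closure \<Omega> f \<longleftrightarrow>
     (\<exists>g. continuous_on (closure \<Omega>) g \<and> (\<forall>x\<in>\<Omega>. g x = f x))"

text \<open>For open \<open>\<Omega>\<close>: all partial derivatives of \<open>f\<close> of order at most \<open>k\<close> exist in \<open>\<Omega>\<close> and extend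
  continuously to the closure. Derivatives are only taken at points of \<open>\<Omega>\<close>, so nothing depends
  on the values of \<open>f\<close> outside \<open>\<Omega>\<close>.\<close>

primrec Ck_up_to_boundary :: "nat \<Rightarrow> (real^'n::finite) set \<Rightarrow> (real^'n \<Rightarrow> real) \<Rightarrow> bool" where
  "Ck_up_to_boundary 0 \<Omega> f \<longleftrightarrow> extends_to_closure \<Omega> f"
| "Ck_up_to_boundary (Suc k) \<Omega> f \<longleftrightarrow> extends_to_closure \<Omega> f \<and>
     (\<forall>x\<in>\<Omega>. f differentiable (at x)) \<and>
     (\<forall>i. Ck_up_to_boundary k \<Omega> (partial_deriv i f))"

definition Ck_closure :: "nat \<Rightarrow> (real^'n::finite) set \<Rightarrow> (real^'n \<Rightarrow> real) \<Rightarrow> bool" where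
  "Ck_closure k \<Omega> f \<longleftrightarrow> continuous_on (closure \<Omega>) f \<and> Ck_up_to_boundary k \<Omega> f"

text \<open>For a function that is \<open>C\<^sup>4\<close> up to the boundary, the value of the Laplacian at a boundary point
  is the value there of its continuous extension, i.e. the limit from inside the ball.\<close>

definition classical_solution ::
    "real \<Rightarrow> real \<Rightarrow> real \<Rightarrow> (real^'n::finite \<Rightarrow> real) \<Rightarrow> bool" where
  "classical_solution \<beta> \<tau> \<mu> u \<longleftrightarrow>
     Ck_closure 4 (ball 0 1) u \<and>
     (SUP x\<in>ball 0 1. u x) < 1 \<and>
     (\<forall>x\<in>ball 0 1. \<beta> * laplacian (laplacian u) x - \<tau> * laplacian u x = \<mu> / (1 - u x)^2) \<and>
     (\<forall>x\<in>ball 0 1. 0 < u x) \<and>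
     (\<forall>x\<in>sphere 0 1. u x = 0 \<and> (laplacian u \<longlongrightarrow> 0) (at x within ball 0 1))"

definition minimal_solution ::
    "real \<Rightarrow> real \<Rightarrow> real \<Rightarrow> (real^'n::finite \<Rightarrow> real) \<Rightarrow> bool" where
  "minimal_solution \<beta> \<tau> \<mu> u \<longleftrightarrow> classical_solution \<beta> \<tau> \<mu> u \<and>
     (\<forall>v. classical_solution \<beta> \<tau> \<mu> v \<longrightarrow> (\<forall>x\<in>ball 0 1. u x \<le> v x))"

text \<open>The type argument records the dimension of the underlying space.\<close>

definition solvable_params :: "'n::finite itself \<Rightarrow> real \<Rightarrow> real \<Rightarrow> real set" where
  "solvable_params _ \<beta> \<tau> =
     {\<mu>. 0 < \<mu> \<and> (\<exists>u :: real^'n \<Rightarrow> real. classical_solution \<beta> \<tau> \<mu> u)}"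

definition lambda_star :: "'n::finite itself \<Rightarrow> real \<Rightarrow> real \<Rightarrow> real" where
  "lambda_star T \<beta> \<tau> = Sup (solvable_params T \<beta> \<tau>)"

text \<open>The parameter of the problem is written \<open>\<mu>\<close>, and \<open>\<mu>\<^sup>*\<close> is \<^const>\<open>lambda_star\<close>.
  \<open>U \<mu>\<close> is the minimal solution \<open>u\<^sub>\<mu>\<close>, whose values in the ball are determined by minimality.
  The predicate spells out the known facts that make the limit defining the extremal solution
  meaningful: \<open>0 < \<mu>\<^sup>* < \<infinity>\<close> (the first two conjuncts; they also exclude the junk values of \<open>Sup\<close>
  on the reals), existence of the minimal solutions for \<open>0 < \<mu> < \<mu>\<^sup>*\<close>, and their monotonicity
  in \<open>\<mu>\<close>.\<close>

definition extremal_solution :: "real \<Rightarrow> real \<Rightarrow> (real^'n::finite \<Rightarrow> real) \<Rightarrow> bool" where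
  "extremal_solution \<beta> \<tau> ustar \<longleftrightarrow>
     solvable_params TYPE('n) \<beta> \<tau> \<noteq> {} \<and>
     bdd_above (solvable_params TYPE('n) \<beta> \<tau>) \<and>
     (\<exists>U :: real \<Rightarrow> real^'n \<Rightarrow> real.
        (\<forall>\<mu>\<in>{0<..<lambda_star TYPE('n) \<beta> \<tau>}. minimal_solution \<beta> \<tau> \<mu> (U \<mu>)) \<and>
        (\<forall>x\<in>ball 0 1. mono_on {0<..<lambda_star TYPE('n) \<beta> \<tau>} (\<lambda>\<mu>. U \<mu> x)) \<and>
        (\<forall>x\<in>ball 0 1. ((\<lambda>\<mu>. U \<mu> x) \<longlongrightarrow> ustar x) (at_left (lambda_star TYPE('n) \<beta> \<tau>))))"

definition regular :: "(real^'n::finite \<Rightarrow> real) \<Rightarrow> bool" where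
  "regular u \<longleftrightarrow> (SUP x\<in>ball 0 1. u x) < 1"

end

theory Submission
  imports Defs
begin

text \<open>By minimality and rotation invariance the solutions \<open>u\<^sub>\<mu>\<close> are radial, so everything takes place
  on a half line. For \<open>\<mu> < \<mu>' < \<mu>\<^sup>*\<close> the difference \<open>\<phi> = u\<^sub>\<mu>\<^sub>' - u\<^sub>\<mu>\<close> is a positive supersolution of the
  operator linearised at \<open>u\<^sub>\<mu>\<close>; this replaces the semistability of \<open>u\<^sub>\<mu>\<close>.

  With \<open>\<Lambda> = 8/9 (N - 2/3) (N - 8/3)\<close> and \<open>C\<^sup>3\<close> slightly larger than \<open>\<mu>\<^sup>* / (\<beta> \<Lambda>)\<close>, the function
  \<open>w = 1 - C r\<^bsup>4/3\<^esup> - r\<^sup>2\<close> is a singular supersolution for every \<open>\<mu> < \<mu>\<^sup>*\<close>. If \<open>u\<^sub>\<mu> \<ge> w\<close> held on a long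
  annulus \<open>\<epsilon> \<le> r \<le> \<delta>\<close>, the potential \<open>2 \<mu> / (\<beta> (1 - u\<^sub>\<mu>)\<^sup>3)\<close> would exceed \<open>c r\<^sup>-\<^sup>4\<close> there with \<open>c\<close> above the
  Hardy--Rellich constant \<open>N\<^sup>2 (N - 4)\<^sup>2 / 16\<close> -- this is \<open>2 \<Lambda> > N\<^sup>2 (N - 4)\<^sup>2 / 16\<close>, i.e. \<open>N \<le> 8\<close> --
  contradicting the existence of \<open>\<phi>\<close>. So \<open>w\<close> crosses \<open>u\<^sub>\<mu>\<close> from above somewhere beyond \<open>\<epsilon>\<close>, and comparison
  gives \<open>u\<^sub>\<mu> \<le> w\<close> on \<open>r \<le> \<epsilon>\<close>. Inserting \<open>1 - u\<^sub>\<mu> \<ge> C r\<^bsup>4/3\<^esup>\<close> into the equation and integrating yields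
  \<open>1 - u\<^sub>\<mu> \<le> 1 - u\<^sub>\<mu> 0 + E r\<^bsup>4/3\<^esup> + K r\<^sup>2\<close> with \<open>E < C\<close>, which bounds \<open>u\<^sub>\<mu> 0\<close> away from \<open>1\<close>
  uniformly in \<open>\<mu>\<close>.\<close>

section \<open>The radial system\<close>

text \<open>The points where f is nonnegative form a compact set, and its least element is the zero.
  It drives continuation arguments: a sign that holds at a persists up to c.\<close>

lemma first_zero:
  fixes f :: "real \<Rightarrow> real"
  assumes "continuous_on {a..b} f" "a \<le> b" "f a < 0" "f b \<ge> 0"
  shows "\<exists>c\<in>{a..b}. f c = 0 \<and> (\<forall>x\<in>{a..c}. f x \<le> 0)"
proof -
  let ?S = "{x \<in> {a..b}. f x \<in> {0..}}"
  have "closed ?S"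
    using continuous_closed_preimage[OF assms(1), of "{0..}"] by (simp add: vimage_def Int_def)
  then have "compact ?S"
    unfolding compact_eq_bounded_closed by (auto intro: bounded_subset[of "{a..b}"])
  moreover have "?S \<noteq> {}" using assms by auto
  ultimately obtain c where c: "c \<in> ?S" "\<And>x. x \<in> ?S \<Longrightarrow> c \<le> x"
    using compact_attains_inf[of ?S] by blast
  have "\<exists>y\<ge>a. y \<le> c \<and> f y = 0"
    by (rule IVT') (use c assms continuous_on_subset[OF assms(1), of "{a..c}"] in auto)
  then obtain y where y: "a \<le> y" "y \<le> c" "f y = 0" by auto
  then have "f c = 0" using c(2)[of y] c(1) by (cases "y = c") auto
  moreover have "f x \<le> 0" if "x \<in> {a..c}" for x
  proof (cases "f x \<ge> 0")
    case True
    then have "x = c" using c(2)[of x] c(1) that by auto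
    then show ?thesis using \<open>f c = 0\<close> by simp
  qed simp
  ultimately show ?thesis using c(1) by auto
qed

lemma last_zero:
  fixes f :: "real \<Rightarrow> real"
  assumes "continuous_on {a..b} f" "a \<le> b" "f b < 0" "f a \<ge> 0"
  shows "\<exists>c\<in>{a..b}. f c = 0 \<and> (\<forall>x\<in>{c..b}. f x \<le> 0)"
proof -
  have "continuous_on {-b..-a} (\<lambda>x. f (-x))"
    by (rule continuous_on_compose2[OF assms(1)]) (auto intro!: continuous_intros)
  from first_zero[OF this] assms obtain c
    where c: "c \<in> {-b..-a}" "f (-c) = 0" "\<forall>x\<in>{-b..c}. f (-x) \<le> 0" by auto
  have "f x \<le> 0" if "x \<in> {-c..b}" for x
    using c(3)[rule_format, of "-x"] that by auto
  with c show ?thesis by (intro bexI[of _ "-c"]) auto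
qed

text \<open>The radial form of \<open>\<Delta>\<^sup>2 h - \<tau> \<Delta> h = g\<close> in dimension \<open>n + 1\<close>, with \<open>z = - \<Delta> h\<close>. The
  conditions at \<open>0\<close> say that the fluxes of \<open>h\<close> and \<open>z\<close> have no point source there; \<open>z\<close> itself may
  be unbounded.\<close>

definition radial_system ::
  "nat \<Rightarrow> real \<Rightarrow> (real \<Rightarrow> real) \<Rightarrow> (real \<Rightarrow> real) \<Rightarrow> (real \<Rightarrow> real) \<Rightarrow> (real \<Rightarrow> real) \<Rightarrow> (real \<Rightarrow> real) \<Rightarrow> bool"
  where "radial_system n \<tau> h h1 z z1 g \<longleftrightarrow>
    (\<forall>r\<in>{0<..<1}.
      (h has_real_derivative h1 r) (at r) \<and>
      (h1 has_real_derivative - (n / r) * h1 r - z r) (at r) \<and>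
      (z has_real_derivative z1 r) (at r) \<and>
      (z1 has_real_derivative - (n / r) * z1 r + \<tau> * z r - g r) (at r)) \<and>
    ((\<lambda>r. r ^ n * h1 r) \<longlongrightarrow> 0) (at_right 0) \<and>
    ((\<lambda>r. r ^ n * z1 r) \<longlongrightarrow> 0) (at_right 0) \<and>
    continuous_on {0..<1} h"

lemma radial_systemD:
  assumes "radial_system n \<tau> h h1 z z1 g" "0 < r" "r < 1"
  shows "(h has_real_derivative h1 r) (at r)"
    and "(h1 has_real_derivative - (n / r) * h1 r - z r) (at r)"
    and "(z has_real_derivative z1 r) (at r)"
    and "(z1 has_real_derivative - (n / r) * z1 r + \<tau> * z r - g r) (at r)"
  using assms unfolding radial_system_def by auto

text \<open>The system is linear. With c = -1 this yields differences of solutions and barriers,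
  with c > 0 the lifted function in \<open>stable_comparison\<close>.\<close>

lemma radial_system_scaled_add:
  assumes "radial_system n \<tau> h h1 z z1 g" "radial_system n \<tau> k k1 y y1 f"
  shows "radial_system n \<tau> (\<lambda>r. h r + c * k r) (\<lambda>r. h1 r + c * k1 r) (\<lambda>r. z r + c * y r)
    (\<lambda>r. z1 r + c * y1 r) (\<lambda>r. g r + c * f r)"
proof -
  have "((\<lambda>r. r ^ n * h1 r + c * (r ^ n * k1 r)) \<longlongrightarrow> 0 + c * 0) (at_right 0)"
    "((\<lambda>r. r ^ n * z1 r + c * (r ^ n * y1 r)) \<longlongrightarrow> 0 + c * 0) (at_right 0)"
    by (intro tendsto_add tendsto_mult_left; use assms in \<open>simp add: radial_system_def\<close>)+
  moreover have "continuous_on {0..<1} (\<lambda>r. h r + c * k r)"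
    using assms unfolding radial_system_def by (auto intro!: continuous_intros)
  moreover have
    "((\<lambda>r. h r + c * k r) has_real_derivative h1 r + c * k1 r) (at r)"
    "((\<lambda>r. h1 r + c * k1 r) has_real_derivative - (n / r) * (h1 r + c * k1 r) - (z r + c * y r)) (at r)"
    "((\<lambda>r. z r + c * y r) has_real_derivative z1 r + c * y1 r) (at r)"
    "((\<lambda>r. z1 r + c * y1 r) has_real_derivative
        - (n / r) * (z1 r + c * y1 r) + \<tau> * (z r + c * y r) - (g r + c * f r)) (at r)"
    if "r \<in> {0<..<1}" for r
    using radial_systemD[OF assms(1), of r] radial_systemD[OF assms(2), of r] that
    by (auto intro!: derivative_eq_intros simp: algebra_simps)
  ultimately show ?thesis unfolding radial_system_def by (auto simp: algebra_simps)
qed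

text \<open>r ^ n is the integrating factor of the first-order term, so the sign of z, or of \<tau>
  z - g, decides whether a flux increases or decreases.\<close>

lemma radial_flux_deriv:
  assumes "radial_system n \<tau> h h1 z z1 g" "0 < r" "r < 1"
  shows "((\<lambda>r. r ^ n * h1 r) has_real_derivative - (r ^ n * z r)) (at r)"
    and "((\<lambda>r. r ^ n * z1 r) has_real_derivative r ^ n * (\<tau> * z r - g r)) (at r)"
proof -
  note D = radial_systemD[OF assms]
  \<comment> \<open>For n = 0 the exponent n - Suc 0 truncates to 0, but then the factor n vanishes
    as well.\<close>
  have *: "real n * (r ^ (n - Suc 0) * c) = r ^ n * ((n / r) * c)" for c
    using assms(2) by (cases n) (auto simp: field_simps)
  show "((\<lambda>r. r ^ n * h1 r) has_real_derivative - (r ^ n * z r)) (at r)"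
    by (rule derivative_eq_intros D refl)+ (use * [of "h1 r"] * [of "z1 r"] in \<open>simp add: algebra_simps\<close>)
  show "((\<lambda>r. r ^ n * z1 r) has_real_derivative r ^ n * (\<tau> * z r - g r)) (at r)"
    by (rule derivative_eq_intros D refl)+ (use * [of "h1 r"] * [of "z1 r"] in \<open>simp add: algebra_simps\<close>)
qed

section \<open>Sign and comparison principles for the radial system\<close>

lemma radial_z_cont:
  assumes "radial_system n \<tau> h h1 z z1 g" "0 < a" "b < 1"
  shows "continuous_on {a..b} z"
  by (rule DERIV_continuous_on[OF has_field_derivative_at_within[OF radial_systemD(3)[OF assms(1)]]])
    (use assms in auto)

text \<open>As long as z \<le> 0, the flux r ^ n * z1 is nonincreasing, because \<tau> z - g \<le>
  0. A positive flux at a would stay at least as large all the way to the origin, against its limit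
  0. So it is nonpositive at a, and from there on the flux and z keep each other going down.\<close>

lemma radial_z_decreasing_once_negative:
  assumes sys: "radial_system n \<tau> h h1 z z1 g" and "\<tau> \<ge> 0"
    and "0 < a" "a \<le> x" "x < 1" and g: "\<And>r. 0 < r \<Longrightarrow> r \<le> x \<Longrightarrow> g r \<ge> 0" and neg: "z a < 0"
  shows "z x \<le> z a"
proof -
  define P where "P r = r ^ n * z1 r" for r
  have P': "(P has_real_derivative r ^ n * (\<tau> * z r - g r)) (at r)" if "0 < r" "r < 1" for r
    unfolding P_def[abs_def] by (rule radial_flux_deriv[OF sys that])
  have anti: "P d \<le> P c" if "0 < c" "c \<le> d" "d \<le> x" "\<And>r. c \<le> r \<Longrightarrow> r \<le> d \<Longrightarrow> z r \<le> 0" for c d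
  proof (rule DERIV_nonpos_imp_nonincreasing[OF that(2)])
    fix r assume r: "c \<le> r" "r \<le> d"
    have "r ^ n * (\<tau> * z r - g r) \<le> 0"
      using r that mult_nonneg_nonpos[OF \<open>\<tau> \<ge> 0\<close> that(4)[OF r]] g[of r]
      by (intro mult_nonneg_nonpos) auto
    then show "\<exists>y. (P has_real_derivative y) (at r) \<and> y \<le> 0"
      using P'[of r] r that assms by fastforce
  qed
  have Pa: "P a \<le> 0"
  proof (rule ccontr)
    assume pos: "\<not> P a \<le> 0"
    \<comment> \<open>Going inward from a, a positive flux makes z still smaller, so z cannot return
      to 0 and the lower bound on the flux remains available.\<close>
    have zneg: "z y < 0" if y: "0 < y" "y \<le> a" for y
    proof (rule ccontr)
      assume "\<not> z y < 0"
      then obtain c where c: "c \<in> {y..a}" "z c = 0" "\<forall>x\<in>{c..a}. z x \<le> 0"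
        using last_zero[OF radial_z_cont[OF sys, of y a]] y assms by auto
      have "z c \<le> z a"
      proof (rule DERIV_nonneg_imp_nondecreasing[of c a z])
        fix r assume r: "c \<le> r" "r \<le> a"
        have "P r > 0" using anti[of r a] r c y assms pos by force
        then have "z1 r > 0" unfolding P_def using r c y by (simp add: zero_less_mult_iff)
        then show "\<exists>y. (z has_real_derivative y) (at r) \<and> 0 \<le> y"
          using radial_systemD(3)[OF sys, of r] r c y assms by (auto intro!: exI[of _ "z1 r"])
      qed (use c in auto)
      then show False using c neg by auto
    qed
    have Pr: "P r \<ge> P a" if "0 < r" "r \<le> a" for r
      using anti[of r a] that assms zneg by (meson less_eq_real_def order_less_le_trans)
    have "eventually (\<lambda>r. P r < P a) (at_right 0)"
      using sys pos unfolding radial_system_def P_def[abs_def] by (intro order_tendstoD(2)[of _ 0]) auto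
    moreover have "eventually (\<lambda>r. 0 < r \<and> r \<le> a) (at_right 0)"
      using eventually_at_right_less[of "0::real"] eventually_at_right[of 0 a] assms
      by (auto simp: eventually_at_right_field intro!: exI[of _ a])
    ultimately have "eventually (\<lambda>r. False) (at_right (0::real))"
      by eventually_elim (use Pr in force)
    then show False by simp
  qed
  have mono: "z y \<le> z a" if "a \<le> y" "y \<le> x" "\<And>r. a \<le> r \<Longrightarrow> r \<le> y \<Longrightarrow> z r \<le> 0" for y
  proof (rule DERIV_nonpos_imp_nonincreasing[OF that(1)])
    fix r assume r: "a \<le> r" "r \<le> y"
    have "P r \<le> 0" using anti[of a r] Pa r that assms by force
    then have "z1 r \<le> 0" unfolding P_def using r assms(3)
      by (metis mult_pos_pos not_le zero_less_power order_less_le_trans)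
    then show "\<exists>y. (z has_real_derivative y) (at r) \<and> y \<le> 0"
      using radial_systemD(3)[OF sys, of r] r that assms by (auto intro!: exI[of _ "z1 r"])
  qed
  \<comment> \<open>Up to a first return to 0 the bound \<open>mono\<close> applies and keeps z at
    most z a < 0, so no return occurs.\<close>
  have "z y < 0" if y: "a \<le> y" "y \<le> x" for y
  proof (rule ccontr)
    assume "\<not> z y < 0"
    then obtain c where c: "c \<in> {a..y}" "z c = 0" "\<forall>x\<in>{a..c}. z x \<le> 0"
      using first_zero[OF radial_z_cont[OF sys, of a y]] y assms by auto
    then show False using mono[of c] y neg by auto
  qed
  then show ?thesis using mono[of x] assms by force
qed

lemma radial_z_nonneg:
  assumes "radial_system n \<tau> h h1 z z1 g" "\<tau> \<ge> 0" "b < 1"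
    and "\<And>r. 0 < r \<Longrightarrow> r \<le> b \<Longrightarrow> g r \<ge> 0" "z b \<ge> 0" "0 < r" "r \<le> b"
  shows "z r \<ge> 0"
proof (rule ccontr)
  assume "\<not> z r \<ge> 0"
  then have "z b \<le> z r"
    using assms by (intro radial_z_decreasing_once_negative[OF assms(1,2)]) auto
  with \<open>\<not> z r \<ge> 0\<close> \<open>z b \<ge> 0\<close> show False by simp
qed

lemma radial_z_nonneg_of_tendsto:
  assumes sys: "radial_system n \<tau> h h1 z z1 g" and "\<tau> \<ge> 0"
    and g: "\<And>r. 0 < r \<Longrightarrow> r < 1 \<Longrightarrow> g r \<ge> 0" and lim: "(z \<longlongrightarrow> 0) (at_left 1)" and r: "0 < r" "r < 1"
  shows "z r \<ge> 0"
proof (rule ccontr)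
  assume neg: "\<not> z r \<ge> 0"
  have "eventually (\<lambda>x. z x \<le> z r) (at_left 1)"
    using radial_z_decreasing_once_negative[OF sys \<open>\<tau> \<ge> 0\<close> r(1)] g neg r
    by (auto simp: eventually_at_left_field intro!: exI[of _ r])
  from tendsto_upperbound[OF lim this] neg show False by auto
qed

text \<open>The flux r ^ n * h1 starts from 0 at the origin and has derivative - r ^ n * z.\<close>

lemma radial_flux_nonpos:
  assumes sys: "radial_system n \<tau> h h1 z z1 g" and b: "0 < b" "b < 1"
    and z: "\<And>r. 0 < r \<Longrightarrow> r \<le> b \<Longrightarrow> z r \<ge> 0"
  shows "h1 b \<le> 0"
proof -
  define Q where "Q r = r ^ n * h1 r" for r
  have "Q b \<le> Q r" if "0 < r" "r \<le> b" for r
  proof (rule DERIV_nonpos_imp_nonincreasing[OF that(2)])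
    fix x assume x: "r \<le> x" "x \<le> b"
    show "\<exists>y. (Q has_real_derivative y) (at x) \<and> y \<le> 0"
      using radial_flux_deriv(1)[OF sys, of x] z[of x] x that b unfolding Q_def[abs_def]
      by (auto intro!: exI[of _ "- (x ^ n * z x)"])
  qed
  then have "eventually (\<lambda>r. Q b \<le> Q r) (at_right 0)"
    using b by (auto simp: eventually_at_right_field intro!: exI[of _ b])
  moreover have "(Q \<longlongrightarrow> 0) (at_right 0)"
    using sys unfolding radial_system_def Q_def[abs_def] by auto
  ultimately have "Q b \<le> 0" by (intro tendsto_lowerbound[of Q 0 "at_right 0"]) auto
  then show ?thesis unfolding Q_def using b by (metis mult_pos_pos not_le zero_less_power)
qed

text \<open>Since \<open>z\<close> changes sign at most once, and from plus to minus, \<open>r\<^sup>n h'\<close> first decreases from \<open>0\<close>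
  and then increases; its sign at the right end therefore decides.\<close>

lemma radial_comparison:
  assumes sys: "radial_system n \<tau> h h1 z z1 g" and "\<tau> \<ge> 0" and b: "b < 1"
    and g: "\<And>r. 0 < r \<Longrightarrow> r \<le> b \<Longrightarrow> g r \<ge> 0" and hb: "h1 b \<le> 0" and r: "0 < r" "r \<le> b"
  shows "h1 r \<le> 0"
proof (cases "\<forall>x. 0 < x \<and> x \<le> r \<longrightarrow> z x \<ge> 0")
  case True
  then show ?thesis using radial_flux_nonpos[OF sys, of r] r b by auto
next
  case False
  then obtain a where a: "0 < a" "a \<le> r" "z a < 0" by force
  have neg: "z x < 0" if "a \<le> x" "x \<le> b" for x
    using radial_z_decreasing_once_negative[OF sys \<open>\<tau> \<ge> 0\<close> a(1) that(1) _ g a(3)] that b a by force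
  have "r ^ n * h1 r \<le> b ^ n * h1 b"
  proof (rule DERIV_nonneg_imp_nondecreasing[OF r(2)])
    fix x assume x: "r \<le> x" "x \<le> b"
    then have "- (x ^ n * z x) \<ge> 0" using neg[of x] a by (simp add: mult_nonneg_nonpos)
    then show "\<exists>y. ((\<lambda>a. a ^ n * h1 a) has_real_derivative y) (at x) \<and> 0 \<le> y"
      using radial_flux_deriv(1)[OF sys, of x] x b r by auto
  qed
  also have "\<dots> \<le> 0" using hb r by (simp add: mult_nonneg_nonpos)
  finally show ?thesis using r by (metis mult_pos_pos not_le zero_less_power)
qed

lemma radial_antimono:
  assumes sys: "radial_system n \<tau> h h1 z z1 g" and b: "b < 1"
    and h1: "\<And>r. 0 < r \<Longrightarrow> r \<le> b \<Longrightarrow> h1 r \<le> 0" and r: "0 \<le> r" "r \<le> s" "s \<le> b"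
  shows "h s \<le> h r"
proof (rule DERIV_nonpos_imp_decreasing_open[OF r(2)])
  \<comment> \<open>At r = 0 only continuity of h is known; derivatives are used on the open
    interval alone.\<close>
  show "continuous_on {r..s} h"
    using sys r b unfolding radial_system_def by (auto intro: continuous_on_subset)
  fix x assume "r < x" "x < s"
  then show "\<exists>y. (h has_real_derivative y) (at x) \<and> y \<le> 0"
    using radial_systemD(1)[OF sys, of x] h1[of x] r b by auto
qed

text \<open>\<open>radial_solution n \<tau> \<nu>\<close> is \<open>(P\<^sub>\<mu>)\<close> divided by \<open>\<beta>\<close>, for radial functions.\<close>

definition radial_solution ::
  "nat \<Rightarrow> real \<Rightarrow> real \<Rightarrow> (real \<Rightarrow> real) \<Rightarrow> (real \<Rightarrow> real) \<Rightarrow> (real \<Rightarrow> real) \<Rightarrow> (real \<Rightarrow> real) \<Rightarrow> bool"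
  where "radial_solution n \<tau> \<nu> h h1 z z1 \<longleftrightarrow>
    radial_system n \<tau> h h1 z z1 (\<lambda>r. \<nu> / (1 - h r)\<^sup>2) \<and> (z \<longlongrightarrow> 0) (at_left 1) \<and>
    continuous_on {0..1} h \<and> h 1 = 0 \<and> (\<forall>r. 0 \<le> r \<and> r < 1 \<longrightarrow> 0 < h r \<and> h r < 1)"

lemma radial_solutionD:
  assumes "radial_solution n \<tau> \<nu> h h1 z z1"
  shows "radial_system n \<tau> h h1 z z1 (\<lambda>r. \<nu> / (1 - h r)\<^sup>2)" "(z \<longlongrightarrow> 0) (at_left 1)"
    "continuous_on {0..1} h" "h 1 = 0" "\<And>r. 0 \<le> r \<Longrightarrow> r < 1 \<Longrightarrow> 0 < h r" "\<And>r. 0 \<le> r \<Longrightarrow> r < 1 \<Longrightarrow> h r < 1"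
  using assms unfolding radial_solution_def by auto

section \<open>A Hardy--Rellich inequality on an interval\<close>

text \<open>For \<open>P p = - p'' - 2 p' + A p\<close>, a positive supersolution of \<open>P\<^sup>* P p = c p\<close> on a long interval
  forces \<open>c \<le> A\<^sup>2\<close> up to a small error: test with \<open>\<psi>\<^sup>2 / p\<close>, \<open>\<psi> = sin\<^sup>2\<close>, and use Picone's
  inequality \<open>P p \<cdot> P (\<psi>\<^sup>2 / p) \<le> (P \<psi>)\<^sup>2\<close>; the boundary terms are the function \<open>F\<close>.\<close>

lemma picone_interval:
  fixes p p1 q q1 G :: "real \<Rightarrow> real" and A c \<tau> \<theta> s\<^sub>0 s\<^sub>1 :: real
  assumes \<theta>: "\<theta> > 0" and s1: "s\<^sub>1 = s\<^sub>0 + pi / \<theta>" and "\<tau> \<ge> 0" "A \<ge> 0"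
    and p: "\<And>s. s\<^sub>0 \<le> s \<Longrightarrow> s \<le> s\<^sub>1 \<Longrightarrow> p s > 0" and q: "\<And>s. s\<^sub>0 \<le> s \<Longrightarrow> s \<le> s\<^sub>1 \<Longrightarrow> q s \<ge> 0"
    and dp: "\<And>s. s\<^sub>0 \<le> s \<Longrightarrow> s \<le> s\<^sub>1 \<Longrightarrow> (p has_real_derivative p1 s) (at s)"
    and dp1: "\<And>s. s\<^sub>0 \<le> s \<Longrightarrow> s \<le> s\<^sub>1 \<Longrightarrow>
      (p1 has_real_derivative - 2 * p1 s + A * p s - q s) (at s)"
    and dq: "\<And>s. s\<^sub>0 \<le> s \<Longrightarrow> s \<le> s\<^sub>1 \<Longrightarrow> (q has_real_derivative q1 s) (at s)"
    and dq1: "\<And>s. s\<^sub>0 \<le> s \<Longrightarrow> s \<le> s\<^sub>1 \<Longrightarrow>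
      (q1 has_real_derivative 2 * q1 s + A * q s - G s) (at s)"
    and G: "\<And>s. s\<^sub>0 \<le> s \<Longrightarrow> s \<le> s\<^sub>1 \<Longrightarrow> G s \<ge> c * p s - \<tau> * exp (2 * s) * q s"
  shows "c * (3 / 8) \<le> A\<^sup>2 * (3 / 8) + (4 + 2 * A) * \<theta>\<^sup>2 / 2 + 2 * \<theta> ^ 4
    + \<tau> * exp (2 * s\<^sub>1) * (\<theta>\<^sup>2 / 2 + 3 * A / 8)"
proof -
  define S where "S s = sin (\<theta> * (s - s\<^sub>0))" for s
  define K where "K s = cos (\<theta> * (s - s\<^sub>0))" for s
  have dS [derivative_intros]: "(S has_real_derivative \<theta> * K s) (at s)" for s
    unfolding S_def[abs_def] K_def by (auto intro!: derivative_eq_intros)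
  have dK [derivative_intros]: "(K has_real_derivative - (\<theta> * S s)) (at s)" for s
    unfolding S_def K_def[abs_def] by (auto intro!: derivative_eq_intros)
  have K2: "(K s)\<^sup>2 = 1 - (S s)\<^sup>2" for s unfolding S_def K_def by (simp add: cos_squared_eq)
  define \<psi> where "\<psi> s = (S s)\<^sup>2" for s
  define \<psi>1 where "\<psi>1 s = 2 * \<theta> * S s * K s" for s
  define \<psi>2 where "\<psi>2 s = 2 * \<theta>\<^sup>2 * ((K s)\<^sup>2 - (S s)\<^sup>2)" for s
  have d\<psi> [derivative_intros]: "(\<psi> has_real_derivative \<psi>1 s) (at s)" for s
    unfolding \<psi>_def[abs_def] \<psi>1_def by (auto intro!: derivative_eq_intros simp: power2_eq_square)
  have d\<psi>1 [derivative_intros]: "(\<psi>1 has_real_derivative \<psi>2 s) (at s)" for s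
    unfolding \<psi>1_def[abs_def] \<psi>2_def
    by (auto intro!: derivative_eq_intros simp: power2_eq_square algebra_simps)
  \<comment> \<open>\<open>I0\<close>, \<open>I1\<close>, \<open>I2\<close> are antiderivatives of
    \<psi>^2, \<psi>1^2, \<psi>2^2. Their linear parts carry the mean values 3/8, \<theta>^2 / 2 and
    2 \<theta>^4; the other terms vanish where S = 0. W is sin (4 x) / 4 with x = \<theta> (s -
    \<open>s\<^sub>0\<close>).\<close>
  define W where "W s = S s * K s * ((K s)\<^sup>2 - (S s)\<^sup>2)" for s
  define I0 where "I0 s = 3 * s / 8 - 3 / 8 * (S s * K s) / \<theta> - (S s ^ 3 * K s) / (4 * \<theta>)" for s
  define I1 where "I1 s = \<theta>\<^sup>2 * (s / 2 - W s / (2 * \<theta>))" for s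
  define I2 where "I2 s = 4 * \<theta> ^ 4 * (s / 2 + W s / (2 * \<theta>))" for s
  have dI0: "(I0 has_real_derivative (\<psi> s)\<^sup>2) (at s)" for s
  proof -
    have "(I0 has_real_derivative 3 / 8 - 3 / 8 * ((K s)\<^sup>2 - (S s)\<^sup>2) - (3 * (S s)\<^sup>2 * (K s)\<^sup>2 - S s ^ 4) / 4) (at s)"
      unfolding I0_def[abs_def] using \<theta>
      by (auto intro!: derivative_eq_intros simp: field_simps power2_eq_square power3_eq_cube power4_eq_xxxx)
    also have "3 / 8 - 3 / 8 * ((K s)\<^sup>2 - (S s)\<^sup>2) - (3 * (S s)\<^sup>2 * (K s)\<^sup>2 - S s ^ 4) / 4 = (\<psi> s)\<^sup>2"
      unfolding K2 \<psi>_def by (simp add: field_simps power2_eq_square power4_eq_xxxx)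
    finally show ?thesis .
  qed
  have dW: "(W has_real_derivative
      \<theta> * (1 - 8 * (S s)\<^sup>2 * (K s)\<^sup>2)) (at s)" for s
  proof -
    have "(W has_real_derivative
      \<theta> * (((K s)\<^sup>2 - (S s)\<^sup>2)\<^sup>2 - 4 * (S s)\<^sup>2 * (K s)\<^sup>2)) (at s)"
      unfolding W_def[abs_def]
      by (auto intro!: derivative_eq_intros simp: algebra_simps power2_eq_square power4_eq_xxxx)
    also have "((K s)\<^sup>2 - (S s)\<^sup>2)\<^sup>2 - 4 * (S s)\<^sup>2 * (K s)\<^sup>2 = 1 - 8 * (S s)\<^sup>2 * (K s)\<^sup>2"
      unfolding K2 by (simp add: algebra_simps power2_eq_square)
    finally show ?thesis .
  qed
  have dI1: "(I1 has_real_derivative (\<psi>1 s)\<^sup>2) (at s)" for s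
    unfolding I1_def[abs_def] \<psi>1_def using \<theta>
    by (auto intro!: derivative_eq_intros dW simp: field_simps power2_eq_square power4_eq_xxxx)
  have dI2: "(I2 has_real_derivative (\<psi>2 s)\<^sup>2) (at s)" for s
  proof -
    have "(I2 has_real_derivative 4 * \<theta> ^ 4 * (1 - 4 * (S s)\<^sup>2 * (K s)\<^sup>2)) (at s)"
      unfolding I2_def[abs_def] using \<theta>
      by (auto intro!: derivative_eq_intros dW simp: field_simps power2_eq_square power4_eq_xxxx)
    also have "4 * \<theta> ^ 4 * (1 - 4 * (S s)\<^sup>2 * (K s)\<^sup>2) = (\<psi>2 s)\<^sup>2"
      unfolding \<psi>2_def power_mult_distrib K2 by (simp add: algebra_simps power2_eq_square power4_eq_xxxx)
    finally show ?thesis .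
  qed
  \<comment> \<open>T bounds the weight \<tau> exp (2 s) on the whole interval.\<close>
  define T where "T = \<tau> * exp (2 * s\<^sub>1)"
  \<comment> \<open>With P \<psi> = - \<psi>2 - 2 \<psi>1 + A \<psi>, this is an antiderivative of c
    \<psi>^2 - (P \<psi>)^2 - T (A \<psi>^2 + \<psi>1^2). Expanding the square leaves mixed
    products; up to a multiple of \<psi>1^2 they are total derivatives, which are the last three
    terms.\<close>
  define E where "E s = (c - A\<^sup>2 - T * A) * I0 s - (4 + 2 * A + T) * I1 s - I2 s
    - 2 * (\<psi>1 s)\<^sup>2 + 2 * A * (\<psi> s)\<^sup>2 + 2 * A * (\<psi> s * \<psi>1 s)" for s
  have dE: "(E has_real_derivative c * (\<psi> s)\<^sup>2 - (- \<psi>2 s - 2 * \<psi>1 s + A * \<psi> s)\<^sup>2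
      - T * (A * (\<psi> s)\<^sup>2 + (\<psi>1 s)\<^sup>2)) (at s)" for s
    unfolding E_def[abs_def]
    by (auto intro!: derivative_eq_intros dI0 dI1 dI2 simp: algebra_simps power2_eq_square)
  define g where "g s = (\<psi> s)\<^sup>2 / p s" for s
  define g1 where "g1 s = 2 * \<psi> s * \<psi>1 s / p s - (\<psi> s)\<^sup>2 * p1 s / (p s)\<^sup>2" for s
  \<comment> \<open>The part without \<tau> has derivative G g - q P g, since P p = q and G is the
    formal adjoint of P applied to q. The \<tau> part uses p1' + 2 p1 = A p - q to trade the term
    \<tau> exp (2 s) q g, which has no useful bound, for A p g + p1 g1.\<close>
  define F where "F s = - q1 s * g s + q s * g1 s + 2 * q s * g s - \<tau> * (exp (2 * s) * p1 s * g s)" for s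
  have "F s\<^sub>0 - E s\<^sub>0 \<le> F s\<^sub>1 - E s\<^sub>1"
  proof (rule DERIV_nonneg_imp_nondecreasing[of s\<^sub>0 s\<^sub>1 "\<lambda>s. F s - E s"])
    show "s\<^sub>0 \<le> s\<^sub>1" using s1 \<theta> by simp
    fix s assume s: "s\<^sub>0 \<le> s" "s \<le> s\<^sub>1"
    note [derivative_intros] = dp[OF s] dp1[OF s] dq[OF s] dq1[OF s]
    have ps: "p s > 0" and qs: "q s \<ge> 0" using p q s by auto
    define pp where "pp = - 2 * p1 s + A * p s - q s"
    define g2 where "g2 = 2 * (\<psi>1 s)\<^sup>2 / p s + 2 * \<psi> s * \<psi>2 s / p s - 4 * \<psi> s * \<psi>1 s * p1 s / (p s)\<^sup>2
       - (\<psi> s)\<^sup>2 * pp / (p s)\<^sup>2 + 2 * (\<psi> s)\<^sup>2 * (p1 s)\<^sup>2 / (p s) ^ 3"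
    have dg: "(g has_real_derivative g1 s) (at s)"
      unfolding g_def[abs_def] g1_def using ps
      by (auto intro!: derivative_eq_intros simp: field_simps power2_eq_square)
    have dg1: "(g1 has_real_derivative g2) (at s)"
      unfolding g1_def[abs_def] g2_def pp_def using ps
      by (auto intro!: derivative_eq_intros simp: field_simps power2_eq_square power3_eq_cube)
    have dF: "(F has_real_derivative G s * g s - q s * (- g2 - 2 * g1 s + A * g s)
        - \<tau> * exp (2 * s) * (A * p s * g s - q s * g s + p1 s * g1 s)) (at s)"
      unfolding F_def[abs_def]
      by (auto intro!: derivative_eq_intros dg dg1 simp: algebra_simps)
    have gs: "g s \<ge> 0" unfolding g_def using ps by simp
    have "(c * p s - \<tau> * exp (2 * s) * q s) * g s \<le> G s * g s"
      by (rule mult_right_mono[OF G[OF s] gs])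
    then have 1: "c * (\<psi> s)\<^sup>2 - \<tau> * exp (2 * s) * q s * g s \<le> G s * g s"
      unfolding g_def using ps by (simp add: field_simps)
    have pic: "q s * (- g2 - 2 * g1 s + A * g s) \<le> (- \<psi>2 s - 2 * \<psi>1 s + A * \<psi> s)\<^sup>2"
    proof -
      \<comment> \<open>l is the derivative of k = \<psi> / p. In terms of k and l the defect in
        Picone's inequality is a square plus 2 q p l^2, hence nonnegative because q \<ge> 0 and p >
        0.\<close>
      define k where "k = \<psi> s / p s"
      define l where "l = (\<psi>1 s - k * p1 s) / p s"
      have k: "\<psi> s = k * p s" and l: "\<psi>1 s = l * p s + k * p1 s"
        unfolding k_def l_def using ps by auto
      have "g s = k\<^sup>2 * p s" "g1 s = 2 * k * l * p s + k\<^sup>2 * p1 s"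
        "g2 = 2 * k * \<psi>2 s - k\<^sup>2 * pp + 2 * l\<^sup>2 * p s"
        unfolding g_def g1_def g2_def k l using ps
        by (simp_all add: field_simps power2_eq_square power3_eq_cube)
      note g = this
      have "(- \<psi>2 s - 2 * \<psi>1 s + A * \<psi> s)\<^sup>2 - q s * (- g2 - 2 * g1 s + A * g s)
          = (- \<psi>2 s - 2 * \<psi>1 s + A * \<psi> s - k * q s)\<^sup>2 + 2 * q s * p s * l\<^sup>2"
        unfolding g unfolding k l pp_def by (simp add: algebra_simps power2_eq_square)
      moreover have "\<dots> \<ge> 0" using ps qs by simp
      ultimately show ?thesis by linarith
    qed
    have tau: "\<tau> * exp (2 * s) * (A * p s * g s + p1 s * g1 s) \<le> T * (A * (\<psi> s)\<^sup>2 + (\<psi>1 s)\<^sup>2)"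
    proof -
      \<comment> \<open>Completing the square removes the uncontrolled quotient p1 / p.\<close>
      have "p1 s * g1 s = (\<psi>1 s)\<^sup>2 - (\<psi>1 s - \<psi> s * p1 s / p s)\<^sup>2"
        unfolding g1_def using ps by (simp add: field_simps power2_eq_square)
      moreover have "A * p s * g s = A * (\<psi> s)\<^sup>2" unfolding g_def using ps by simp
      ultimately have "A * p s * g s + p1 s * g1 s \<le> A * (\<psi> s)\<^sup>2 + (\<psi>1 s)\<^sup>2"
        using zero_le_power2[of "\<psi>1 s - \<psi> s * p1 s / p s"] by linarith
      moreover have "\<tau> * exp (2 * s) \<le> T"
        unfolding T_def using s \<open>\<tau> \<ge> 0\<close> by (intro mult_left_mono) auto
      ultimately show ?thesis
        using \<open>\<tau> \<ge> 0\<close> \<open>A \<ge> 0\<close> by (smt (verit) exp_ge_zero mult_left_mono mult_nonneg_nonneg mult_right_mono zero_le_power2)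
    qed
    show "\<exists>y. ((\<lambda>s. F s - E s) has_real_derivative y) (at s) \<and> 0 \<le> y"
      using DERIV_diff[OF dF dE[of s]] 1 pic tau
      by (intro exI conjI) (assumption, simp add: algebra_simps)
  qed
  \<comment> \<open>Every term of g and g1 contains \<psi>, so F vanishes at both ends and only the
    linear parts of E survive.\<close>
  moreover have zero: "S s\<^sub>0 = 0" "S s\<^sub>1 = 0"
    unfolding S_def s1 using \<theta> by auto
  moreover have "F s\<^sub>0 = 0" "F s\<^sub>1 = 0"
    unfolding F_def g_def g1_def \<psi>_def zero by auto
  ultimately have "E s\<^sub>1 \<le> E s\<^sub>0" by simp
  moreover have "E s\<^sub>1 - E s\<^sub>0
      = (s\<^sub>1 - s\<^sub>0) * ((c - A\<^sup>2 - T * A) * (3 / 8) - (4 + 2 * A + T) * \<theta>\<^sup>2 / 2 - 2 * \<theta> ^ 4)"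
    unfolding E_def I0_def I1_def I2_def W_def \<psi>_def \<psi>1_def zero by (simp add: field_simps)
  moreover have "s\<^sub>1 - s\<^sub>0 > 0" using s1 \<theta> by simp
  ultimately have "(c - A\<^sup>2 - T * A) * (3 / 8) - (4 + 2 * A + T) * \<theta>\<^sup>2 / 2 - 2 * \<theta> ^ 4 \<le> 0"
    by (smt (verit) mult_pos_pos)
  then show ?thesis unfolding T_def by (simp add: algebra_simps add_divide_distrib)
qed

section \<open>Barriers and stability\<close>

text \<open>The exponent 4/3 is the one for which the fourth-order term r^(-8/3) scales like
  (r^(4/3))^(-2), the singular nonlinearity. The term K r^2 adds a constant to z. The right-hand
  side is whatever makes the equation exact.\<close>

lemma radial_barrier:
  assumes n: "n \<ge> 2"
  shows "radial_system n \<tau> (\<lambda>r. c - C * r powr (4/3) - K * r\<^sup>2)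
    (\<lambda>r. - (4/3 * C * r powr (1/3)) - 2 * K * r)
    (\<lambda>r. 4/3 * C * (real n + 1/3) * r powr (-2/3) + 2 * K * (real n + 1))
    (\<lambda>r. - (8/9 * C * (real n + 1/3) * r powr (-5/3)))
    (\<lambda>r. \<tau> * (4/3 * C * (real n + 1/3) * r powr (-2/3) + 2 * K * (real n + 1))
      + 8/9 * C * (real n + 1/3) * (real n - 5/3) * r powr (-8/3))"
  unfolding radial_system_def
proof (intro conjI ballI)
  fix r :: real assume "r \<in> {0<..<1}"
  then have r: "r > 0" by simp
  have d: "((\<lambda>r. r powr a) has_real_derivative a * r powr (a - 1)) (at r)" for a
    by (rule has_real_derivative_powr[OF r])
  have p: "r powr (1/3) = r * r powr (-2/3)" "r powr - (5/3) = r * r powr - (8/3)"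
    using r powr_add[of r 1 "-2/3"] powr_add[of r 1 "-8/3"] by simp_all
  show "((\<lambda>r. c - C * r powr (4/3) - K * r\<^sup>2) has_real_derivative
      - (4/3 * C * r powr (1/3)) - 2 * K * r) (at r)"
    by (rule derivative_eq_intros d refl)+ simp
  show "((\<lambda>r. - (4/3 * C * r powr (1/3)) - 2 * K * r) has_real_derivative
      - (real n / r) * (- (4/3 * C * r powr (1/3)) - 2 * K * r)
      - (4/3 * C * (real n + 1/3) * r powr (-2/3) + 2 * K * (real n + 1))) (at r)"
    by (rule derivative_eq_intros d refl)+ (use r in \<open>simp add: p(1) field_simps\<close>)
  show "((\<lambda>r. 4/3 * C * (real n + 1/3) * r powr (-2/3) + 2 * K * (real n + 1)) has_real_derivative
      - (8/9 * C * (real n + 1/3) * r powr (-5/3))) (at r)"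
    by (rule derivative_eq_intros d refl)+ simp
  show "((\<lambda>r. - (8/9 * C * (real n + 1/3) * r powr (-5/3))) has_real_derivative
      - (real n / r) * (- (8/9 * C * (real n + 1/3) * r powr (-5/3)))
      + \<tau> * (4/3 * C * (real n + 1/3) * r powr (-2/3) + 2 * K * (real n + 1))
      - (\<tau> * (4/3 * C * (real n + 1/3) * r powr (-2/3) + 2 * K * (real n + 1))
        + 8/9 * C * (real n + 1/3) * (real n - 5/3) * r powr (-8/3))) (at r)"
    by (rule DERIV_cong[OF DERIV_minus[OF DERIV_cmult[OF d]]]) (use r in \<open>simp add: p(2) field_simps\<close>)
next
  have lim: "((\<lambda>r. r powr (1/3)) \<longlongrightarrow> 0) (at_right (0::real))"
    by (rule tendsto_zero_powrI[of _ _ _ "1/3"])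
      (auto intro!: tendsto_intros simp: eventually_at_right_less eventually_at_filter)
  have pow: "((\<lambda>r. r ^ m) \<longlongrightarrow> 0 ^ m) (at_right (0::real))" for m
    by (intro tendsto_intros)
  have "((\<lambda>r. r ^ n * (- (4/3 * C * r powr (1/3)) - 2 * K * r)) \<longlongrightarrow>
      0 ^ n * (- (4/3 * C * 0) - 2 * K * 0)) (at_right 0)"
    by (intro tendsto_intros lim pow)
  then show "((\<lambda>r. r ^ n * (- (4/3 * C * r powr (1/3)) - 2 * K * r)) \<longlongrightarrow> 0) (at_right 0)"
    by simp
  \<comment> \<open>Since n \<ge> 2, the factor r ^ n absorbs r^(-5/3): the flux of z behaves like
    r^(n - 2) r^(1/3).\<close>
  have "((\<lambda>r. - (8/9 * C * (real n + 1/3) * (r ^ (n - 2) * r powr (1/3)))) \<longlongrightarrow>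
      - (8/9 * C * (real n + 1/3) * (0 ^ (n - 2) * 0))) (at_right 0)"
    by (intro tendsto_intros lim pow)
  moreover have "\<forall>\<^sub>F r in at_right 0. - (8/9 * C * (real n + 1/3) * (r ^ (n - 2) * r powr (1/3)))
      = r ^ n * (- (8/9 * C * (real n + 1/3) * r powr (-5/3)))"
    unfolding eventually_at_right_field
  proof (intro exI[of _ 1] conjI allI impI)
    fix r :: real assume r: "0 < r"
    have "r powr (1/3) = r\<^sup>2 * r powr (-5/3)" using r powr_add[of r 2 "-5/3"] by simp
    moreover have "r ^ n = r ^ (n - 2) * r\<^sup>2" using n by (metis le_add_diff_inverse2 power_add)
    ultimately show "- (8/9 * C * (real n + 1/3) * (r ^ (n - 2) * r powr (1/3)))
      = r ^ n * (- (8/9 * C * (real n + 1/3) * r powr (-5/3)))" by simp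
  qed simp
  ultimately show "((\<lambda>r. r ^ n * (- (8/9 * C * (real n + 1/3) * r powr (-5/3)))) \<longlongrightarrow> 0) (at_right 0)"
    using Lim_transform_eventually by (simp only: mult_zero_right minus_zero)
  show "continuous_on {0..<1} (\<lambda>r. c - C * r powr (4/3) - K * r\<^sup>2)"
    by (intro continuous_intros continuous_on_powr') auto
qed

text \<open>Here \<open>\<phi>\<close> is a positive supersolution of the linearised operator; the least multiple of it that
  lifts \<open>h\<close> above \<open>0\<close> would produce an interior zero, which the comparison principle excludes.\<close>

lemma stable_comparison:
  assumes h: "radial_system n \<tau> h h1 z z1 g" and \<phi>: "radial_system n \<tau> \<phi> \<phi>1 y y1 f"
    and "\<tau> \<ge> 0" and b: "0 < b" "b < 1"
    and V: "\<And>r. 0 < r \<Longrightarrow> r \<le> b \<Longrightarrow> V r \<ge> 0"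
    and g: "\<And>r. 0 < r \<Longrightarrow> r \<le> b \<Longrightarrow> g r \<ge> V r * h r"
    and f: "\<And>r. 0 < r \<Longrightarrow> r \<le> b \<Longrightarrow> f r \<ge> V r * \<phi> r"
    and pos: "\<And>r. 0 \<le> r \<Longrightarrow> r \<le> b \<Longrightarrow> \<phi> r > 0" and "\<phi>1 b \<le> 0"
    and hb: "h b \<ge> 0" "h1 b \<le> 0" and r: "0 \<le> r" "r \<le> b"
  shows "h r \<ge> 0"
proof -
  have "continuous_on {0..b} h" "continuous_on {0..b} \<phi>"
    using h \<phi> b unfolding radial_system_def by (auto intro: continuous_on_subset)
  then have "continuous_on {0..b} (\<lambda>r. - h r / \<phi> r)"
    using pos by (intro continuous_intros) (auto simp: less_imp_neq[symmetric])
  then have "\<exists>a\<in>{0..b}. \<forall>r\<in>{0..b}. - h r / \<phi> r \<le> - h a / \<phi> a"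
    using b by (intro continuous_attains_sup) auto
  then obtain a where a: "a \<in> {0..b}" "\<And>r. r \<in> {0..b} \<Longrightarrow> - h r / \<phi> r \<le> - h a / \<phi> a"
    by blast
  \<comment> \<open>If positive, M is the least multiple for which h + M \<phi> is nonnegative on
    the interval, with contact at a.\<close>
  define M where "M = - h a / \<phi> a"
  have "M \<le> 0"
  proof (rule ccontr)
    assume M: "\<not> M \<le> 0"
    define k where "k r = h r + M * \<phi> r" for r
    note k = radial_system_scaled_add[OF h \<phi>, of M, folded k_def]
    have k0: "k r \<ge> 0" if "0 \<le> r" "r \<le> b" for r
      using a(2)[of r] pos[OF that] that unfolding k_def M_def[symmetric] by (simp add: field_simps)
    have ka: "k a = 0" unfolding k_def M_def using pos[of a] a(1) by simp
    \<comment> \<open>The source dominates V k, and k \<ge> 0. Comparison then makes k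
      nonincreasing, which is impossible for k a = 0 and k b > 0.\<close>
    have "g r + M * f r \<ge> 0" if "0 < r" "r \<le> b" for r
    proof -
      have "V r * k r \<le> g r + M * f r"
        unfolding k_def using g[OF that] mult_left_mono[OF f[OF that] less_imp_le[OF M[unfolded not_le]]]
        by (simp add: algebra_simps)
      then show ?thesis using V[OF that] k0[of r] that by (meson less_eq_real_def mult_nonneg_nonneg order_trans)
    qed
    then have "h1 r + M * \<phi>1 r \<le> 0" if "0 < r" "r \<le> b" for r
      using radial_comparison[OF k \<open>\<tau> \<ge> 0\<close> b(2) _ _ that] hb(2) \<open>\<phi>1 b \<le> 0\<close> M
      by (simp add: add_nonpos_nonpos mult_nonneg_nonpos)
    then have "k b \<le> k a" using radial_antimono[OF k b(2)] a(1) by auto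
    moreover have "k b > 0" unfolding k_def using hb(1) M pos[of b] b by (simp add: add_nonneg_pos)
    ultimately show False using ka by simp
  qed
  then have "- h r / \<phi> r \<le> 0" using a(2)[of r] r unfolding M_def by simp
  then show ?thesis using pos[OF r] by (simp add: zero_le_divide_iff)
qed

text \<open>Tangent line at t of the convex function s \<mapsto> 1 / (1 - s)^2; the remainder is
  explicit, with numerator (a - b)^2 (a + 2 b).\<close>

lemma mems_convex:
  fixes s t :: real
  assumes "s < 1" "t < 1"
  shows "1 / (1 - s)\<^sup>2 \<ge> 1 / (1 - t)\<^sup>2 + 2 / (1 - t) ^ 3 * (s - t)"
proof -
  define a b where "a = 1 - t" and "b = 1 - s"
  have ab: "a > 0" "b > 0" "s - t = a - b" using assms by (auto simp: a_def b_def)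
  have "1 / b\<^sup>2 - (1 / a\<^sup>2 + 2 / a ^ 3 * (a - b)) = (a - b)\<^sup>2 * (a + 2 * b) / (a ^ 3 * b\<^sup>2)"
    using ab(1,2) by (simp add: field_simps power2_eq_square power3_eq_cube)
  also have "\<dots> \<ge> 0" using ab(1,2) by simp
  finally show ?thesis unfolding ab(3) a_def[symmetric] b_def[symmetric] by simp
qed

text \<open>The substitution r = exp s turns the radial system into the constant-coefficient one of
  \<open>picone_interval\<close>, up to the \<tau> term, on an interval of length pi / \<theta>.
  With N = n + 1, A^2 is the Hardy--Rellich constant N^2 (N - 4)^2 / 16.\<close>

lemma radial_hardy:
  fixes n :: nat
  defines "A \<equiv> (real n + 1) * (real n - 3) / 4"
  assumes sys: "radial_system n \<tau> \<phi> \<phi>1 z z1 g" and "\<tau> \<ge> 0" and n: "n \<ge> 3"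
    and \<theta>: "\<theta> > 0" and \<delta>: "\<delta> = \<epsilon> * exp (pi / \<theta>)" "0 < \<epsilon>" "\<delta> < 1"
    and pos: "\<And>r. \<epsilon> \<le> r \<Longrightarrow> r \<le> \<delta> \<Longrightarrow> \<phi> r > 0" "\<And>r. \<epsilon> \<le> r \<Longrightarrow> r \<le> \<delta> \<Longrightarrow> z r \<ge> 0"
    and g: "\<And>r. \<epsilon> \<le> r \<Longrightarrow> r \<le> \<delta> \<Longrightarrow> g r \<ge> c / r ^ 4 * \<phi> r"
  shows "c * (3 / 8) \<le> A\<^sup>2 * (3 / 8) + (4 + 2 * A) * \<theta>\<^sup>2 / 2 + 2 * \<theta> ^ 4
    + \<tau> * \<delta>\<^sup>2 * (\<theta>\<^sup>2 / 2 + 3 * A / 8)"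
proof -
  \<comment> \<open>This weight makes the first-order coefficients for p and q opposite, so that the
    two second-order operators are formal adjoints.\<close>
  define \<alpha> where "\<alpha> = (real n - 3) / 2"
  have n_\<alpha>: "real n = 2 * \<alpha> + 3" unfolding \<alpha>_def by (simp add: field_simps)
  have A: "A = \<alpha> * (\<alpha> + 2)" unfolding A_def n_\<alpha> by (simp add: field_simps)
  define p where "p s = exp (\<alpha> * s) * \<phi> (exp s)" for s
  define p1 where "p1 s = \<alpha> * p s + exp (\<alpha> * s) * exp s * \<phi>1 (exp s)" for s
  define q where "q s = exp (\<alpha> * s) * (exp s)\<^sup>2 * z (exp s)" for s
  define q1 where "q1 s = (\<alpha> + 2) * q s + exp (\<alpha> * s) * exp s ^ 3 * z1 (exp s)" for s
  define G where "G s = exp (\<alpha> * s) * exp s ^ 4 * (g (exp s) - \<tau> * z (exp s))" for s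
  have rng: "\<epsilon> \<le> exp s" "exp s \<le> \<delta>" "0 < exp s" "exp s < 1" if "ln \<epsilon> \<le> s" "s \<le> ln \<delta>" for s
  proof -
    have "\<delta> > 0" using \<delta> by simp
    show *: "\<epsilon> \<le> exp s" "exp s \<le> \<delta>"
      using that \<delta>(2) \<open>\<delta> > 0\<close> exp_le_cancel_iff[of "ln \<epsilon>" s] exp_le_cancel_iff[of s "ln \<delta>"] by simp_all
    show "0 < exp s" by simp
    show "exp s < 1" by (rule le_less_trans[OF *(2) \<delta>(3)])
  qed
  have "c * (3 / 8) \<le> A\<^sup>2 * (3 / 8) + (4 + 2 * A) * \<theta>\<^sup>2 / 2 + 2 * \<theta> ^ 4
    + \<tau> * exp (2 * ln \<delta>) * (\<theta>\<^sup>2 / 2 + 3 * A / 8)"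
  proof (rule picone_interval[of \<theta> "ln \<delta>" "ln \<epsilon>" \<tau> A p q p1 q1 G c])
    show "ln \<delta> = ln \<epsilon> + pi / \<theta>" unfolding \<delta>(1) using \<delta>(2) by (simp add: ln_mult)
    show "A \<ge> 0" using n by (simp add: A_def)
    fix s assume s: "ln \<epsilon> \<le> s" "s \<le> ln \<delta>"
    note r = rng[OF s]
    show "p s > 0" "q s \<ge> 0" unfolding p_def q_def using pos r by auto
    have D: "((\<lambda>s. F (exp s)) has_real_derivative F' * exp s) (at s)"
      if "(F has_real_derivative F') (at (exp s))" for F F'
      using DERIV_chain2[OF that DERIV_exp] by simp
    note D = D[OF radial_systemD(1)[OF sys r(3,4)]] D[OF radial_systemD(2)[OF sys r(3,4)]]
      D[OF radial_systemD(3)[OF sys r(3,4)]] D[OF radial_systemD(4)[OF sys r(3,4)]]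
    show dp: "(p has_real_derivative p1 s) (at s)"
      unfolding p_def[abs_def] p1_def by (rule derivative_eq_intros D refl)+ (simp add: algebra_simps)
    show "(p1 has_real_derivative - 2 * p1 s + A * p s - q s) (at s)"
      unfolding p1_def[abs_def] A
      by (rule derivative_eq_intros D dp refl)+
        (simp add: p1_def q_def n_\<alpha> field_simps power2_eq_square)
    show dq: "(q has_real_derivative q1 s) (at s)"
      unfolding q_def[abs_def] q1_def
      by (rule derivative_eq_intros D refl)+ (simp add: q_def algebra_simps power2_eq_square power3_eq_cube)
    show "(q1 has_real_derivative 2 * q1 s + A * q s - G s) (at s)"
      unfolding q1_def[abs_def] A
      by (rule derivative_eq_intros D dq refl)+
        (simp add: q1_def G_def n_\<alpha> field_simps power2_eq_square power3_eq_cube power4_eq_xxxx)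
    have "c * p s = exp s ^ 4 * exp (\<alpha> * s) * (c / exp s ^ 4 * \<phi> (exp s))"
      unfolding p_def by simp
    also have "\<dots> \<le> exp s ^ 4 * exp (\<alpha> * s) * g (exp s)"
      using g r by (intro mult_left_mono) auto
    finally show "G s \<ge> c * p s - \<tau> * exp (2 * s) * q s"
      unfolding G_def q_def exp_double by (simp add: algebra_simps exp_double power2_eq_square power4_eq_xxxx)
  qed (use assms in auto)
  also have "exp (2 * ln \<delta>) = \<delta>\<^sup>2" using \<delta> by (simp add: exp_double)
  finally show ?thesis .
qed

text \<open>Differentiating the zero function repeatedly kills h1, z, z1 and then g. It supplies the
  strict positivity in \<open>radial_solution_diff\<close>.\<close>

lemma radial_system_eq_0_on_interval:
  assumes sys: "radial_system n \<tau> h h1 z z1 g" and ab: "0 \<le> a" "b \<le> 1"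
    and h: "\<And>x. x \<in> {a<..<b} \<Longrightarrow> h x = 0" and r: "r \<in> {a<..<b}"
  shows "g r = 0"
proof -
  have zero: "f' r = 0"
    if "\<And>x. x \<in> {a<..<b} \<Longrightarrow> f x = 0" "\<And>x. x \<in> {a<..<b} \<Longrightarrow> (f has_real_derivative f' x) (at x)"
      "r \<in> {a<..<b}" for f f' :: "real \<Rightarrow> real" and r
  proof -
    have "(f has_real_derivative 0) (at r)"
      by (rule has_field_derivative_transform_within_open[of "\<lambda>_. 0" _ _ "{a<..<b}"]) (use that in auto)
    then show ?thesis using that(2)[OF that(3)] DERIV_unique by blast
  qed
  have D: "(h has_real_derivative h1 x) (at x)" "(h1 has_real_derivative - (n / x) * h1 x - z x) (at x)"
    "(z has_real_derivative z1 x) (at x)" "(z1 has_real_derivative - (n / x) * z1 x + \<tau> * z x - g x) (at x)"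
    if "x \<in> {a<..<b}" for x
    using radial_systemD[OF sys, of x] that ab by auto
  have h1: "h1 x = 0" if "x \<in> {a<..<b}" for x by (rule zero[OF h D(1) that])
  have z: "z x = 0" if "x \<in> {a<..<b}" for x using zero[OF h1 D(2) that] h1[OF that] by simp
  have z1: "z1 x = 0" if "x \<in> {a<..<b}" for x by (rule zero[OF z D(3) that])
  show ?thesis using zero[OF z1 D(4) r] z1[OF r] z[OF r] by simp
qed

text \<open>Two mean values: h varies by less than 1, which bounds - h1 by 2 / \<epsilon> at some
  \<rho>; the flux at \<rho> then bounds z at some \<xi> between \<rho> / 2 and \<rho>. The factor 2
  ^ n pays for \<rho> \<le> 2 \<xi>. The bound does not depend on the solution.\<close>

lemma radial_z_bounded_somewhere:
  assumes sys: "radial_system n \<tau> h h1 z z1 g" and \<epsilon>: "0 < \<epsilon>" "\<epsilon> < 1"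
    and z: "\<And>r. 0 < r \<Longrightarrow> r < 1 \<Longrightarrow> z r \<ge> 0" and h: "\<And>r. 0 < r \<Longrightarrow> r < 1 \<Longrightarrow> 0 < h r \<and> h r < 1"
  shows "\<exists>\<xi>. \<epsilon> / 4 \<le> \<xi> \<and> \<xi> \<le> \<epsilon> \<and> z \<xi> \<le> 8 * 2 ^ n / \<epsilon>\<^sup>2"
proof -
  have "\<exists>\<rho>>\<epsilon>/2. \<rho> < \<epsilon> \<and> h \<epsilon> - h (\<epsilon>/2) = (\<epsilon> - \<epsilon>/2) * h1 \<rho>"
    by (rule MVT2) (use \<epsilon> radial_systemD(1)[OF sys] in auto)
  then obtain \<rho> where \<rho>: "\<epsilon>/2 < \<rho>" "\<rho> < \<epsilon>" "h \<epsilon> - h (\<epsilon>/2) = (\<epsilon> - \<epsilon>/2) * h1 \<rho>" by blast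
  have "\<exists>\<xi>>\<rho>/2. \<xi> < \<rho> \<and> \<rho> ^ n * h1 \<rho> - (\<rho>/2) ^ n * h1 (\<rho>/2) = (\<rho> - \<rho>/2) * - (\<xi> ^ n * z \<xi>)"
    by (rule MVT2) (use \<epsilon> \<rho> radial_flux_deriv(1)[OF sys] in auto)
  then obtain \<xi> where \<xi>: "\<rho>/2 < \<xi>" "\<xi> < \<rho>"
    "\<rho> ^ n * h1 \<rho> - (\<rho>/2) ^ n * h1 (\<rho>/2) = (\<rho> - \<rho>/2) * - (\<xi> ^ n * z \<xi>)" by blast
  have "h1 (\<rho>/2) \<le> 0" using radial_flux_nonpos[OF sys, of "\<rho>/2"] z \<rho> \<epsilon> by auto
  then have "(\<rho>/2) ^ n * h1 (\<rho>/2) \<le> 0" using \<rho> \<epsilon> by (intro mult_nonneg_nonpos) auto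
  then have 1: "\<rho>/2 * (\<xi> ^ n * z \<xi>) \<le> \<rho> ^ n * - h1 \<rho>" using \<xi>(3) by simp
  have h1: "- h1 \<rho> \<le> 2 / \<epsilon>"
    using \<rho>(3) h[of \<epsilon>] h[of "\<epsilon>/2"] \<epsilon> by (simp add: field_simps)
  have z\<xi>: "z \<xi> \<ge> 0" using z \<xi> \<rho> \<epsilon> by auto
  have "(\<epsilon>/4) * (\<xi> ^ n * z \<xi>) \<le> \<rho>/2 * (\<xi> ^ n * z \<xi>)"
    using \<rho> \<xi> \<epsilon> z\<xi> by (intro mult_right_mono) auto
  also have "\<dots> \<le> \<rho> ^ n * (2 / \<epsilon>)" using 1 mult_left_mono[OF h1, of "\<rho> ^ n"] \<rho> \<epsilon> by simp
  also have "\<dots> \<le> (2 * \<xi>) ^ n * (2 / \<epsilon>)"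
    using \<rho> \<xi> \<epsilon> by (intro mult_right_mono power_mono) auto
  finally have "\<xi> ^ n * (\<epsilon>/4 * z \<xi>) \<le> \<xi> ^ n * (2 ^ n * (2 / \<epsilon>))"
    by (simp add: power_mult_distrib mult_ac)
  moreover have "\<xi> ^ n > 0" using \<rho> \<xi> \<epsilon> by simp
  ultimately have "\<epsilon>/4 * z \<xi> \<le> 2 ^ n * (2 / \<epsilon>)" by (simp only: mult_le_cancel_left_pos)
  then have "z \<xi> \<le> 8 * 2 ^ n / \<epsilon>\<^sup>2" using \<epsilon> by (simp add: field_simps power2_eq_square)
  then show ?thesis using \<rho> \<xi> by (intro exI[of _ \<xi>]) auto
qed

section \<open>Radial solutions, their differences and the singular barrier\<close>

lemma radial_solution_z_nonneg:
  assumes "radial_solution n \<tau> \<nu> h h1 z z1" "\<tau> \<ge> 0" "\<nu> \<ge> 0" "0 < r" "r < 1"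
  shows "z r \<ge> 0"
  by (rule radial_z_nonneg_of_tendsto[OF radial_solutionD(1)[OF assms(1)] assms(2)])
    (use assms radial_solutionD(2)[OF assms(1)] in auto)

lemma radial_solution_le_center:
  assumes "radial_solution n \<tau> \<nu> h h1 z z1" "\<tau> \<ge> 0" "\<nu> \<ge> 0" "0 \<le> r" "r < 1"
  shows "h r \<le> h 0"
proof (rule radial_antimono[OF radial_solutionD(1)[OF assms(1)] assms(5)])
  fix s assume "0 < s" "s \<le> r"
  then show "h1 s \<le> 0"
    using radial_flux_nonpos[OF radial_solutionD(1)[OF assms(1)], of s]
      radial_solution_z_nonneg[OF assms(1-3)] assms(5) by auto
qed (use assms in auto)

text \<open>For \<phi> = k - h convexity gives the linearised inequality, with a surplus \<nu>' -
  \<nu> > 0 since 1 / (1 - k)^2 \<ge> 1. The surplus gives strict positivity: \<phi> is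
  nonincreasing, so a zero would spread to an interval up to 1 and force f = 0 there.\<close>

lemma radial_solution_diff:
  assumes h: "radial_solution n \<tau> \<nu> h h1 z z1" and k: "radial_solution n \<tau> \<nu>' k k1 y y1"
    and "\<tau> \<ge> 0" and \<nu>: "0 \<le> \<nu>" "\<nu> < \<nu>'" and le: "\<And>r. 0 \<le> r \<Longrightarrow> r < 1 \<Longrightarrow> h r \<le> k r"
  obtains \<phi> \<phi>1 x x1 f where "radial_system n \<tau> \<phi> \<phi>1 x x1 f"
    and "\<And>r. 0 \<le> r \<Longrightarrow> r < 1 \<Longrightarrow> \<phi> r > 0" and "\<And>r. 0 < r \<Longrightarrow> r < 1 \<Longrightarrow> \<phi>1 r \<le> 0"
    and "\<And>r. 0 < r \<Longrightarrow> r < 1 \<Longrightarrow> x r \<ge> 0"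
    and "\<And>r. 0 < r \<Longrightarrow> r < 1 \<Longrightarrow> f r \<ge> 2 * \<nu> / (1 - h r) ^ 3 * \<phi> r"
proof -
  define \<phi> where "\<phi> r = k r + (-1) * h r" for r
  define \<phi>1 where "\<phi>1 r = k1 r + (-1) * h1 r" for r
  define x where "x r = y r + (-1) * z r" for r
  define x1 where "x1 r = y1 r + (-1) * z1 r" for r
  define f where "f r = \<nu>' / (1 - k r)\<^sup>2 + (-1) * (\<nu> / (1 - h r)\<^sup>2)" for r
  note h' = radial_solutionD[OF h] and k' = radial_solutionD[OF k]
  have sys: "radial_system n \<tau> \<phi> \<phi>1 x x1 f"
    unfolding \<phi>_def \<phi>1_def x_def x1_def f_def by (rule radial_system_scaled_add[OF k'(1) h'(1)])
  have \<phi>0: "\<phi> r \<ge> 0" if "0 \<le> r" "r < 1" for r using le[OF that] by (simp add: \<phi>_def)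
  have f: "f r \<ge> 2 * \<nu> / (1 - h r) ^ 3 * \<phi> r + (\<nu>' - \<nu>)" if r: "0 < r" "r < 1" for r
  proof -
    have "(1 - k r)\<^sup>2 \<le> 1" using k'(5,6)[of r] r by (intro power_le_one) auto
    then have "1 \<le> 1 / (1 - k r)\<^sup>2" using k'(6)[of r] r by (simp add: field_simps)
    then have "\<nu>' - \<nu> \<le> (\<nu>' - \<nu>) * (1 / (1 - k r)\<^sup>2)" using mult_left_mono[of 1 "1 / (1 - k r)\<^sup>2" "\<nu>' - \<nu>"] \<nu> by simp
    moreover have "\<nu> * (1 / (1 - h r)\<^sup>2 + 2 / (1 - h r) ^ 3 * (k r - h r)) \<le> \<nu> * (1 / (1 - k r)\<^sup>2)"
      using \<nu> h'(6)[of r] k'(6)[of r] r by (intro mult_left_mono mems_convex) auto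
    ultimately show ?thesis unfolding f_def \<phi>_def
      by (simp add: algebra_simps diff_divide_distrib add_divide_distrib)
  qed
  have V: "2 * \<nu> / (1 - h r) ^ 3 * \<phi> r \<ge> 0" if "0 < r" "r < 1" for r
    using \<phi>0[of r] h'(6)[of r] that \<nu> by simp
  have fpos: "f r > 0" if "0 < r" "r < 1" for r using f[OF that] V[OF that] \<nu> by linarith
  have "((\<lambda>r. y r + (-1) * z r) \<longlongrightarrow> 0 + (-1) * 0) (at_left 1)"
    by (intro tendsto_intros h'(2) k'(2))
  then have "(x \<longlongrightarrow> 0) (at_left 1)" by (simp add: x_def[abs_def])
  then have x: "x r \<ge> 0" if "0 < r" "r < 1" for r
    using radial_z_nonneg_of_tendsto[OF sys \<open>\<tau> \<ge> 0\<close>] fpos that by (simp add: less_imp_le)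
  have \<phi>1: "\<phi>1 r \<le> 0" if "0 < r" "r < 1" for r
    using radial_flux_nonpos[OF sys that] x that by auto
  have "\<phi> r > 0" if r: "0 \<le> r" "r < 1" for r
  proof (rule ccontr)
    assume "\<not> \<phi> r > 0"
    then have "\<phi> s = 0" if "s \<in> {r<..<1}" for s
      using radial_antimono[OF sys, of s r s] \<phi>1 that r \<phi>0[of s] by auto
    then have "f ((r + 1) / 2) = 0"
      by (intro radial_system_eq_0_on_interval[OF sys r(1), of 1]) (use r in auto)
    then show False using fpos[of "(r + 1) / 2"] r by simp
  qed
  moreover have "f r \<ge> 2 * \<nu> / (1 - h r) ^ 3 * \<phi> r" if "0 < r" "r < 1" for r
    using f[OF that] \<nu> by linarith
  ultimately show ?thesis using that[OF sys _ \<phi>1 x] by blast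
qed

text \<open>A lower bound C r^(4/3) on m limits the nonlinearity to a multiple of r^(-8/3). E = C
  gives the singular supersolution; a separate E serves in \<open>center_below_one\<close>.\<close>

lemma barrier_supersolution:
  fixes n :: nat
  assumes n: "n \<ge> 2" and "C > 0" "\<tau> \<ge> 0" "K \<ge> 0" "r > 0"
    and \<nu>: "0 \<le> \<nu>" "\<nu> \<le> 8/9 * (real n + 1/3) * (real n - 5/3) * (E * C\<^sup>2)" and "E \<ge> 0"
    and m: "m \<ge> C * r powr (4/3)"
  shows "\<nu> / m\<^sup>2 \<le> \<tau> * (4/3 * E * (real n + 1/3) * r powr (-2/3) + 2 * K * (real n + 1))
    + 8/9 * E * (real n + 1/3) * (real n - 5/3) * r powr (-8/3)"
proof -
  have pos: "C * r powr (4/3) > 0" using assms by simp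
  have p: "(r powr (4/3))\<^sup>2 * r powr (-8/3) = 1"
    using \<open>r > 0\<close> by (simp add: power2_eq_square flip: powr_add)
  have "\<nu> / m\<^sup>2 \<le> \<nu> / (C * r powr (4/3))\<^sup>2"
    using m pos less_le_trans[OF pos m] \<nu> by (intro divide_left_mono power_mono mult_pos_pos) auto
  also have "\<dots> \<le> 8/9 * (real n + 1/3) * (real n - 5/3) * (E * C\<^sup>2) / (C * r powr (4/3))\<^sup>2"
    using \<nu> by (intro divide_right_mono) auto
  also have "\<dots> = 8/9 * E * (real n + 1/3) * (real n - 5/3) * r powr (-8/3)"
    using \<open>C > 0\<close> \<open>r > 0\<close> p by (simp add: divide_simps power_mult_distrib mult_ac)
  also have "\<dots> \<le> \<tau> * (4/3 * E * (real n + 1/3) * r powr (-2/3) + 2 * K * (real n + 1)) + \<dots>"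
    using assms by simp
  finally show ?thesis .
qed

text \<open>The constants c and D measure the room above the Hardy--Rellich constant: w \<le> h on
  the annulus would give 1 - h \<le> D r^(4/3), hence a potential of at least c / r^4, which
  \<open>hardy\<close> forbids. From a point with w > h the first crossing further out supplies the
  boundary data for \<open>stable_comparison\<close>.\<close>

lemma barrier_above_near_center:
  fixes n :: nat
  assumes h: "radial_solution n \<tau> \<nu> h h1 z z1" and k: "radial_solution n \<tau> \<nu>' k k1 y y1"
    and "\<tau> \<ge> 0" and \<nu>: "0 \<le> \<nu>" "\<nu> < \<nu>'" and le: "\<And>r. 0 \<le> r \<Longrightarrow> r < 1 \<Longrightarrow> h r \<le> k r"
    and n: "n \<ge> 3" and "C > 0" and C: "\<nu> \<le> 8/9 * (real n + 1/3) * (real n - 5/3) * C ^ 3"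
    and \<theta>: "\<theta> > 0" and \<delta>: "\<delta> = \<epsilon> * exp (pi / \<theta>)" "0 < \<epsilon>" "\<delta> < 1"
    and D: "C + \<delta> powr (2/3) \<le> D" and c: "c > 0" "c * D ^ 3 \<le> 2 * \<nu>"
    and A: "A = (real n + 1) * (real n - 3) / 4"
    and hardy: "c * (3 / 8) > A\<^sup>2 * (3 / 8) + (4 + 2 * A) * \<theta>\<^sup>2 / 2 + 2 * \<theta> ^ 4
      + \<tau> * \<delta>\<^sup>2 * (\<theta>\<^sup>2 / 2 + 3 * A / 8)"
    and r: "0 \<le> r" "r \<le> \<epsilon>"
  shows "h r \<le> 1 - C * r powr (4/3)"
proof -
  note h' = radial_solutionD[OF h]
  obtain \<phi> \<phi>1 x x1 f where \<phi>: "radial_system n \<tau> \<phi> \<phi>1 x x1 f"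
    "\<And>r. 0 \<le> r \<Longrightarrow> r < 1 \<Longrightarrow> \<phi> r > 0" "\<And>r. 0 < r \<Longrightarrow> r < 1 \<Longrightarrow> \<phi>1 r \<le> 0"
    "\<And>r. 0 < r \<Longrightarrow> r < 1 \<Longrightarrow> x r \<ge> 0"
    "\<And>r. 0 < r \<Longrightarrow> r < 1 \<Longrightarrow> f r \<ge> 2 * \<nu> / (1 - h r) ^ 3 * \<phi> r"
    using radial_solution_diff[OF h k \<open>\<tau> \<ge> 0\<close> \<nu> le] by blast
  \<comment> \<open>The term - r^2 makes w 1 = - C < 0 = h 1 for every C > 0, so a crossing inside
    the ball is certain.\<close>
  define w where "w r = 1 - C * r powr (4/3) - 1 * r\<^sup>2" for r
  define w1 where "w1 r = - (4/3 * C * r powr (1/3)) - 2 * 1 * r" for r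
  define v where "v r = 4/3 * C * (real n + 1/3) * r powr (-2/3) + 2 * 1 * (real n + 1)" for r
  define v1 where "v1 r = - (8/9 * C * (real n + 1/3) * r powr (-5/3))" for r
  define gw where "gw r = \<tau> * v r + 8/9 * C * (real n + 1/3) * (real n - 5/3) * r powr (-8/3)" for r
  have w: "radial_system n \<tau> w w1 v v1 gw"
    unfolding w_def w1_def v_def v1_def gw_def by (rule radial_barrier) (use n in simp)
  have gw: "\<nu> / (1 - w r)\<^sup>2 \<le> gw r" if "r > 0" for r
    unfolding gw_def v_def
    by (rule barrier_supersolution[where C=C])
      (use n \<open>C > 0\<close> \<open>\<tau> \<ge> 0\<close> that \<nu>(1) C in \<open>auto simp: w_def power2_eq_square power3_eq_cube mult_ac\<close>)
  have "\<epsilon> < \<delta>" unfolding \<delta>(1) using \<delta>(2) \<theta> by simp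
  have w_less: "w r < 1" if "r > 0" for r unfolding w_def
    using that \<open>C > 0\<close> add_pos_pos[of "C * r powr (4/3)" "r\<^sup>2"] by simp
  have "\<exists>a\<in>{\<epsilon>..\<delta>}. w a > h a"
  proof (rule ccontr)
    assume "\<not> (\<exists>a\<in>{\<epsilon>..\<delta>}. w a > h a)"
    then have wh: "w a \<le> h a" if "\<epsilon> \<le> a" "a \<le> \<delta>" for a using that by force
    have "f a \<ge> c / a ^ 4 * \<phi> a" if a: "\<epsilon> \<le> a" "a \<le> \<delta>" for a
    proof -
      have a': "0 < a" "a < 1" using a \<delta> by auto
      have "1 - h a \<le> C * a powr (4/3) + a\<^sup>2" using wh[OF a] by (simp add: w_def)
      also have "a\<^sup>2 = a powr (4/3) * a powr (2/3)" using a' by (simp flip: powr_add)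
      also have "C * a powr (4/3) + a powr (4/3) * a powr (2/3) = a powr (4/3) * (C + a powr (2/3))"
        by (simp add: algebra_simps)
      also have "\<dots> \<le> a powr (4/3) * D"
        using D a a' powr_mono2[of "2/3" a \<delta>] by (intro mult_left_mono) auto
      finally have "(1 - h a) ^ 3 \<le> (a powr (4/3) * D) ^ 3"
        using h'(6)[of a] a' by (intro power_mono) auto
      also have "\<dots> = a ^ 4 * D ^ 3"
        using a' by (simp add: power_mult_distrib powr_power)
      finally have m: "(1 - h a) ^ 3 \<le> a ^ 4 * D ^ 3" .
      have "c / a ^ 4 * (1 - h a) ^ 3 \<le> c / a ^ 4 * (a ^ 4 * D ^ 3)"
        using c(1) a' by (intro mult_left_mono[OF m]) auto
      also have "\<dots> \<le> 2 * \<nu>" using c(2) a' by simp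
      finally have "c / a ^ 4 \<le> 2 * \<nu> / (1 - h a) ^ 3"
        using h'(6)[of a] a' by (simp add: pos_le_divide_eq)
      then have "c / a ^ 4 * \<phi> a \<le> 2 * \<nu> / (1 - h a) ^ 3 * \<phi> a"
        using \<phi>(2)[of a] a' by (intro mult_right_mono) auto
      then show ?thesis using \<phi>(5)[OF a'] by linarith
    qed
    then have "c * (3 / 8) \<le> A\<^sup>2 * (3 / 8) + (4 + 2 * A) * \<theta>\<^sup>2 / 2 + 2 * \<theta> ^ 4
      + \<tau> * \<delta>\<^sup>2 * (\<theta>\<^sup>2 / 2 + 3 * A / 8)"
      unfolding A using \<phi>(2,4) \<delta>
      by (intro radial_hardy[OF \<phi>(1) \<open>\<tau> \<ge> 0\<close> n \<theta> \<delta>]) auto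
    then show False using hardy by simp
  qed
  then obtain a where a: "\<epsilon> \<le> a" "a \<le> \<delta>" "w a > h a" by auto
  define H where "H r = w r + (-1) * h r" for r
  have "continuous_on {0..1} w" unfolding w_def
    by (intro continuous_intros continuous_on_powr') auto
  then have "continuous_on {0..1} (\<lambda>r. - H r)"
    unfolding H_def using h'(3) by (intro continuous_intros)
  then have "continuous_on {a..1} (\<lambda>r. - H r)"
    by (rule continuous_on_subset) (use a \<delta> in auto)
  moreover have "- H 1 \<ge> 0" unfolding H_def w_def using h'(4) \<open>C > 0\<close> by simp
  ultimately obtain b where b: "b \<in> {a..1}" "H b = 0" "\<And>s. s \<in> {a..b} \<Longrightarrow> H s \<ge> 0"
    using first_zero[of a 1 "\<lambda>r. - H r"] a \<delta> by (auto simp: H_def)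
  have "H 1 \<noteq> 0" unfolding H_def w_def using h'(4) \<open>C > 0\<close> by simp
  then have b1: "b < 1" using b by (cases "b = 1") auto
  have "H a > 0" using a by (simp add: H_def)
  then have "a < b" using b by (cases "a = b") auto
  have b0: "0 < b" using \<open>a < b\<close> a \<delta> by simp
  have H: "radial_system n \<tau> H (\<lambda>r. w1 r + (-1) * h1 r) (\<lambda>r. v r + (-1) * z r)
      (\<lambda>r. v1 r + (-1) * z1 r) (\<lambda>r. gw r + (-1) * (\<nu> / (1 - h r)\<^sup>2))"
    unfolding H_def by (rule radial_system_scaled_add[OF w h'(1)])
  \<comment> \<open>H \<ge> 0 on the interval from a to its zero b; a positive slope at b would make
    H negative just to the left.\<close>
  have slope: "w1 b + (-1) * h1 b \<le> 0"
  proof (rule ccontr)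
    assume "\<not> w1 b + (-1) * h1 b \<le> 0"
    then obtain d where d: "d > 0" "\<And>s. 0 < s \<Longrightarrow> s < d \<Longrightarrow> H (b - s) < H b"
      using DERIV_pos_inc_left[OF radial_systemD(1)[OF H b0 b1]] by auto
    define s where "s = min (d / 2) (b - a)"
    have "H (b - s) < H b" "b - s \<in> {a..b}" using d \<open>a < b\<close> by (auto simp: s_def min_def)
    then show False using b by force
  qed
  have gH: "gw r + (-1) * (\<nu> / (1 - h r)\<^sup>2) \<ge> 2 * \<nu> / (1 - h r) ^ 3 * H r" if "0 < r" "r \<le> b" for r
  proof -
    have "\<nu> * (1 / (1 - h r)\<^sup>2 + 2 / (1 - h r) ^ 3 * (w r - h r)) \<le> \<nu> * (1 / (1 - w r)\<^sup>2)"
      using \<nu> h'(6)[of r] w_less[of r] that b1 by (intro mult_left_mono mems_convex) auto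
    then show ?thesis using gw[OF that(1)] unfolding H_def by (simp add: algebra_simps)
  qed
  have "H r \<ge> 0"
  proof (rule stable_comparison[OF H \<phi>(1) \<open>\<tau> \<ge> 0\<close> b0 b1])
    show "2 * \<nu> / (1 - h s) ^ 3 \<ge> 0" if "0 < s" "s \<le> b" for s
      using \<nu>(1) h'(6)[of s] that b1 by simp
    show "gw s + (-1) * (\<nu> / (1 - h s)\<^sup>2) \<ge> 2 * \<nu> / (1 - h s) ^ 3 * H s" if "0 < s" "s \<le> b" for s
      by (rule gH[OF that])
    show "f s \<ge> 2 * \<nu> / (1 - h s) ^ 3 * \<phi> s" if "0 < s" "s \<le> b" for s
      using \<phi>(5)[of s] that b1 by simp
    show "\<phi> s > 0" if "0 \<le> s" "s \<le> b" for s using \<phi>(2)[of s] that b1 by simp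
    show "\<phi>1 b \<le> 0" by (rule \<phi>(3)[OF b0 b1])
    show "H b \<ge> 0" using b(2) by simp
    show "w1 b + (-1) * h1 b \<le> 0" by (rule slope)
  qed (use r a(1) \<open>a < b\<close> in auto)
  then show ?thesis using zero_le_power2[of r] unfolding H_def w_def by linarith
qed

text \<open>With 1 - h \<ge> C r^(4/3) the source is at most that of h 0 - E r^(4/3) - K r^2, so
  this function stays below h up to \<xi> \<ge> \<epsilon> / 4. Together with the upper bound on h
  at r this is an estimate for h 0.\<close>

lemma center_below_one:
  fixes n :: nat
  assumes h: "radial_solution n \<tau> \<nu> h h1 z z1" and "\<tau> \<ge> 0" and n: "n \<ge> 2"
    and \<epsilon>: "0 < \<epsilon>" "\<epsilon> < 1" and "C > 0" "E \<ge> 0"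
    and \<nu>: "0 \<le> \<nu>" "\<nu> \<le> 8/9 * (real n + 1/3) * (real n - 5/3) * (E * C\<^sup>2)"
    and w: "\<And>r. 0 \<le> r \<Longrightarrow> r \<le> \<epsilon> \<Longrightarrow> h r \<le> 1 - C * r powr (4/3)"
    and r: "0 \<le> r" "r \<le> \<epsilon> / 4"
  shows "h 0 \<le> 1 - (C - E) * r powr (4/3) + 4 * 2 ^ n / (\<epsilon>\<^sup>2 * (real n + 1)) * r\<^sup>2"
proof -
  note h' = radial_solutionD[OF h]
  \<comment> \<open>Chosen so that the constant part 2 K (n + 1) of the barrier's z equals the bound
    on z \<xi>.\<close>
  define K where "K = 4 * 2 ^ n / (\<epsilon>\<^sup>2 * (real n + 1))"
  have "K \<ge> 0" unfolding K_def by simp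
  obtain \<xi> where \<xi>: "\<epsilon> / 4 \<le> \<xi>" "\<xi> \<le> \<epsilon>" "z \<xi> \<le> 8 * 2 ^ n / \<epsilon>\<^sup>2"
    using radial_z_bounded_somewhere[OF h'(1) \<epsilon>] h'(5,6) radial_solution_z_nonneg[OF h \<open>\<tau> \<ge> 0\<close> \<nu>(1)]
    by fastforce
  define k where "k r = (h 0 - E * r powr (4/3) - K * r\<^sup>2) + (-1) * h r" for r
  define x where "x r = (4/3 * E * (real n + 1/3) * r powr (-2/3) + 2 * K * (real n + 1)) + (-1) * z r" for r
  define g where "g r = (\<tau> * (4/3 * E * (real n + 1/3) * r powr (-2/3) + 2 * K * (real n + 1))
      + 8/9 * E * (real n + 1/3) * (real n - 5/3) * r powr (-8/3)) + (-1) * (\<nu> / (1 - h r)\<^sup>2)" for r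
  note sys = radial_system_scaled_add[OF radial_barrier[OF n, of \<tau> "h 0" E K] h'(1), of "-1",
      folded k_def x_def g_def]
  have \<xi>': "0 < \<xi>" "\<xi> < 1" using \<xi> \<epsilon> by auto
  have g: "g s \<ge> 0" if "0 < s" "s \<le> \<xi>" for s
  proof -
    have "C * s powr (4/3) \<le> 1 - h s" using w[of s] that \<xi> by simp
    from barrier_supersolution[OF n \<open>C > 0\<close> \<open>\<tau> \<ge> 0\<close> \<open>K \<ge> 0\<close> that(1) \<nu> \<open>E \<ge> 0\<close> this]
    show ?thesis unfolding g_def by simp
  qed
  have "2 * K * (real n + 1) = 8 * 2 ^ n / \<epsilon>\<^sup>2"
    unfolding K_def using nonzero_mult_divide_mult_cancel_right[of "real n + 1" "8 * 2 ^ n" "\<epsilon>\<^sup>2"] by simp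
  moreover have "4/3 * E * (real n + 1/3) * \<xi> powr (-2/3) \<ge> 0" using \<open>E \<ge> 0\<close> by simp
  ultimately have "x \<xi> \<ge> 0" unfolding x_def using \<xi>(3) by linarith
  then have x: "x s \<ge> 0" if "0 < s" "s \<le> \<xi>" for s
    using radial_z_nonneg[OF sys \<open>\<tau> \<ge> 0\<close> \<xi>'(2) g] that by blast
  have "k r \<le> k 0"
    by (rule radial_antimono[OF sys \<xi>'(2)])
      (use radial_flux_nonpos[OF sys] x \<xi>' \<xi> r in auto)
  moreover have "k 0 = 0" unfolding k_def by simp
  ultimately have "h 0 - E * r powr (4/3) - K * r\<^sup>2 \<le> 1 - C * r powr (4/3)"
    using w[of r] r \<epsilon> unfolding k_def by simp
  then show ?thesis unfolding K_def[symmetric] by (simp add: algebra_simps)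
qed

text \<open>All constants are fixed before any solution is mentioned, which is what makes \<kappa>
  uniform.\<close>

lemma radial_solutions_uniformly_below_one:
  fixes n :: nat
  assumes n: "4 \<le> n" "n \<le> 7" and "\<tau> \<ge> 0" and "\<nu>\<^sub>1 > 0"
  shows "\<exists>\<kappa> \<nu>\<^sub>0. \<kappa> > 0 \<and> 0 < \<nu>\<^sub>0 \<and> \<nu>\<^sub>0 < \<nu>\<^sub>1 \<and>
    (\<forall>\<nu> \<nu>' h h1 z z1 k k1 y y1.
      \<nu>\<^sub>0 < \<nu> \<and> \<nu> < \<nu>' \<and> \<nu>' < \<nu>\<^sub>1 \<and>
      radial_solution n \<tau> \<nu> h h1 z z1 \<and> radial_solution n \<tau> \<nu>' k k1 y y1 \<and>
      (\<forall>r. 0 \<le> r \<and> r < 1 \<longrightarrow> h r \<le> k r) \<longrightarrow> h 0 \<le> 1 - \<kappa>)"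
proof -
  define \<Lambda> where "\<Lambda> = 8/9 * (real n + 1/3) * (real n - 5/3)"
  define A where "A = (real n + 1) * (real n - 3) / 4"
  have "\<Lambda> > 0" "A > 0" unfolding \<Lambda>_def A_def using n by auto
  \<comment> \<open>Checked dimension by dimension; the tightest case n = 7 reads 64 < 5632 /
    81.\<close>
  have "n = 4 \<or> n = 5 \<or> n = 6 \<or> n = 7" using n by auto
  then have crit: "A\<^sup>2 < 2 * \<Lambda>" unfolding A_def \<Lambda>_def by (auto simp: power2_eq_square)
  have "\<nu>\<^sub>1 / \<Lambda> < 2 * \<nu>\<^sub>1 / A\<^sup>2"
    using crit \<open>\<nu>\<^sub>1 > 0\<close> \<open>\<Lambda> > 0\<close> \<open>A > 0\<close> by (simp add: field_simps)
  \<comment> \<open>The strict gap A^2 < 2 \<Lambda> leaves room to choose in turn X = C^3 >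
    \<open>\<nu>\<^sub>1\<close> / \<Lambda>, c > A^2 and Y = D^3 > X with c Y < 2
    \<open>\<nu>\<^sub>1\<close>. Then \<theta> and \<delta> are taken so small that each error uses
    less than half of \<omega>.\<close>
  then obtain X where X: "\<nu>\<^sub>1 / \<Lambda> < X" "X < 2 * \<nu>\<^sub>1 / A\<^sup>2" using dense by blast
  have "\<nu>\<^sub>1 / \<Lambda> > 0" using \<open>\<nu>\<^sub>1 > 0\<close> \<open>\<Lambda> > 0\<close> by simp
  then have "X > 0" using X(1) by linarith
  have "A\<^sup>2 < 2 * \<nu>\<^sub>1 / X" using X(2) \<open>X > 0\<close> \<open>A > 0\<close> by (simp add: field_simps)
  then obtain c where c: "A\<^sup>2 < c" "c < 2 * \<nu>\<^sub>1 / X" using dense by blast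
  have "c > 0" using c(1) zero_le_power2[of A] by linarith
  have "X < 2 * \<nu>\<^sub>1 / c" using c(2) \<open>X > 0\<close> \<open>c > 0\<close> by (simp add: field_simps)
  then obtain Y where Y: "X < Y" "Y < 2 * \<nu>\<^sub>1 / c" using dense by blast
  define C where "C = root 3 X"
  define D where "D = root 3 Y"
  have C: "C > 0" "C ^ 3 = X" and D: "C < D" "D ^ 3 = Y"
    unfolding C_def D_def using \<open>X > 0\<close> Y(1) by auto
  define \<omega> where "\<omega> = c * (3 / 8) - A\<^sup>2 * (3 / 8)"
  have "\<omega> > 0" unfolding \<omega>_def using c(1) by simp

  have "((\<lambda>\<theta>. (4 + 2 * A) * \<theta>\<^sup>2 / 2 + 2 * \<theta> ^ 4) \<longlongrightarrow> (4 + 2 * A) * 0\<^sup>2 / 2 + 2 * 0 ^ 4) (at_right (0::real))"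
    by (intro tendsto_intros) auto
  then have "\<forall>\<^sub>F \<theta> in at_right 0. (4 + 2 * A) * \<theta>\<^sup>2 / 2 + 2 * \<theta> ^ 4 < \<omega> / 2"
    using \<open>\<omega> > 0\<close> by (intro order_tendstoD) auto
  moreover have "\<forall>\<^sub>F \<theta> in at_right (0::real). 0 < \<theta>" by (rule eventually_at_right_less)
  ultimately have "\<forall>\<^sub>F \<theta> in at_right 0. 0 < \<theta> \<and> (4 + 2 * A) * \<theta>\<^sup>2 / 2 + 2 * \<theta> ^ 4 < \<omega> / 2"
    by eventually_elim auto
  then obtain \<theta> where \<theta>: "\<theta> > 0" "(4 + 2 * A) * \<theta>\<^sup>2 / 2 + 2 * \<theta> ^ 4 < \<omega> / 2"
    using eventually_happens'[of "at_right (0::real)"] by auto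

  have pow0: "((\<lambda>r. a * r powr (2/3)) \<longlongrightarrow> 0) (at_right 0)" for a :: real
  proof -
    have "((\<lambda>r. r powr (2/3)) \<longlongrightarrow> 0) (at_right (0::real))"
      by (rule tendsto_zero_powrI[of _ _ _ "2/3"])
        (auto intro!: tendsto_intros simp: eventually_at_right_less eventually_at_filter)
    from tendsto_mult_left[OF this, of a] show ?thesis by simp
  qed
  have "((\<lambda>\<delta>. \<tau> * \<delta>\<^sup>2 * (\<theta>\<^sup>2 / 2 + 3 * A / 8)) \<longlongrightarrow> \<tau> * 0\<^sup>2 * (\<theta>\<^sup>2 / 2 + 3 * A / 8)) (at_right (0::real))"
    by (intro tendsto_intros)
  then have "\<forall>\<^sub>F \<delta> in at_right 0. \<tau> * \<delta>\<^sup>2 * (\<theta>\<^sup>2 / 2 + 3 * A / 8) < \<omega> / 2"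
    using \<open>\<omega> > 0\<close> by (intro order_tendstoD) auto
  moreover have "\<forall>\<^sub>F \<delta> in at_right (0::real). 0 < \<delta>" by (rule eventually_at_right_less)
  moreover have "\<forall>\<^sub>F \<delta> in at_right 0. 1 * \<delta> powr (2/3) < D - C"
    using D(1) by (intro order_tendstoD(2)[OF pow0]) auto
  moreover have "\<forall>\<^sub>F \<delta> in at_right 0. \<delta> < (1::real)"
    unfolding eventually_at_right_field by (intro exI[of _ 1]) auto
  ultimately have "\<forall>\<^sub>F \<delta> in at_right 0. 0 < \<delta> \<and> \<delta> < 1 \<and> C + \<delta> powr (2/3) < D
      \<and> \<tau> * \<delta>\<^sup>2 * (\<theta>\<^sup>2 / 2 + 3 * A / 8) < \<omega> / 2"
    by eventually_elim auto
  then obtain \<delta> where \<delta>: "0 < \<delta>" "\<delta> < 1" "C + \<delta> powr (2/3) < D"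
      "\<tau> * \<delta>\<^sup>2 * (\<theta>\<^sup>2 / 2 + 3 * A / 8) < \<omega> / 2"
    using eventually_happens'[of "at_right (0::real)"] by auto
  \<comment> \<open>The annulus from \<epsilon> to \<delta> has logarithmic length pi /
    \<theta>.\<close>
  define \<epsilon> where "\<epsilon> = \<delta> * exp (- (pi / \<theta>))"
  have \<epsilon>: "\<epsilon> > 0" "\<delta> = \<epsilon> * exp (pi / \<theta>)"
    unfolding \<epsilon>_def using \<delta>(1) by (simp_all add: mult.assoc flip: exp_add)
  have "\<epsilon> \<le> \<delta>" unfolding \<epsilon>_def using \<delta>(1) \<theta>(1) by simp
  then have "\<epsilon> < 1" using \<delta>(2) by simp
  have hardy: "c * (3 / 8) > A\<^sup>2 * (3 / 8) + (4 + 2 * A) * \<theta>\<^sup>2 / 2 + 2 * \<theta> ^ 4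
      + \<tau> * \<delta>\<^sup>2 * (\<theta>\<^sup>2 / 2 + 3 * A / 8)"
  proof -
    have "a + x + y + t < b" if "x + y < (b - a) / 2" "t < (b - a) / 2" for a b x y t :: real
      using that by argo
    then show ?thesis using \<theta>(2) \<delta>(4) unfolding \<omega>_def .
  qed

  \<comment> \<open>The value required by \<open>center_below_one\<close> at the limiting parameter;
    it is below C because \<open>\<nu>\<^sub>1\<close> < \<Lambda> C^3.\<close>
  define E where "E = \<nu>\<^sub>1 / (\<Lambda> * C\<^sup>2)"
  have "E \<ge> 0" unfolding E_def using \<open>\<nu>\<^sub>1 > 0\<close> \<open>\<Lambda> > 0\<close> by simp
  have E: "\<Lambda> * (E * C\<^sup>2) = \<nu>\<^sub>1" unfolding E_def using \<open>\<Lambda> > 0\<close> C(1) by simp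
  have C3: "\<nu>\<^sub>1 < \<Lambda> * C ^ 3" using X(1) \<open>\<Lambda> > 0\<close> C(2) by (simp add: field_simps)
  then have "\<Lambda> * C\<^sup>2 * E < \<Lambda> * C\<^sup>2 * C" using E by (simp add: power2_eq_square power3_eq_cube mult_ac)
  then have EC: "E < C" using \<open>\<Lambda> > 0\<close> C(1) by simp
  define K where "K = 4 * 2 ^ n / (\<epsilon>\<^sup>2 * (real n + 1))"
  have "\<forall>\<^sub>F r in at_right 0. K * r powr (2/3) < (C - E) / 2"
    using EC by (intro order_tendstoD(2)[OF pow0]) auto
  moreover have "\<forall>\<^sub>F r in at_right (0::real). 0 < r" by (rule eventually_at_right_less)
  moreover have "\<forall>\<^sub>F r in at_right 0. r < \<epsilon> / 4"
    unfolding eventually_at_right_field using \<epsilon>(1) by (intro exI[of _ "\<epsilon> / 4"]) auto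
  ultimately have "\<forall>\<^sub>F r in at_right 0. 0 < r \<and> r < \<epsilon> / 4 \<and> K * r powr (2/3) < (C - E) / 2"
    by eventually_elim auto
  then obtain r where r: "0 < r" "r < \<epsilon> / 4" "K * r powr (2/3) < (C - E) / 2"
    using eventually_happens'[of "at_right (0::real)"] by auto
  \<comment> \<open>r is so small that K r^2 uses up at most half of (C - E) r^(4/3); \<kappa> is
    the other half.\<close>
  define \<kappa> where "\<kappa> = (C - E) / 2 * r powr (4/3)"
  have "\<kappa> > 0" unfolding \<kappa>_def using EC r by simp
  \<comment> \<open>Beyond c D^3 / 2 the parameter is large enough for the potential bound.\<close>
  define \<nu>\<^sub>0 where "\<nu>\<^sub>0 = c * Y / 2"
  have "0 < \<nu>\<^sub>0" "\<nu>\<^sub>0 < \<nu>\<^sub>1" unfolding \<nu>\<^sub>0_def using \<open>c > 0\<close> Y \<open>X > 0\<close> by (auto simp: field_simps)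
  have "h 0 \<le> 1 - \<kappa>"
    if \<nu>: "\<nu>\<^sub>0 < \<nu>" "\<nu> < \<nu>'" "\<nu>' < \<nu>\<^sub>1"
      and h: "radial_solution n \<tau> \<nu> h h1 z z1" and k: "radial_solution n \<tau> \<nu>' k k1 y y1"
      and le: "\<And>r. 0 \<le> r \<Longrightarrow> r < 1 \<Longrightarrow> h r \<le> k r"
    for \<nu> \<nu>' h h1 z z1 k k1 y y1
  proof -
    have \<nu>0: "0 \<le> \<nu>" using \<nu> \<open>0 < \<nu>\<^sub>0\<close> by simp
    have w: "h s \<le> 1 - C * s powr (4/3)" if "0 \<le> s" "s \<le> \<epsilon>" for s
    proof (rule barrier_above_near_center[OF h k \<open>\<tau> \<ge> 0\<close> \<nu>0 \<nu>(2) le])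
      show "\<nu> \<le> 8/9 * (real n + 1/3) * (real n - 5/3) * C ^ 3"
        using C3 \<nu> unfolding \<Lambda>_def by linarith
      show "c * D ^ 3 \<le> 2 * \<nu>" using \<nu>(1) unfolding \<nu>\<^sub>0_def D(2) by simp
      show "C + \<delta> powr (2/3) \<le> D" using \<delta>(3) by simp
    qed (use n C(1) \<theta>(1) \<epsilon> \<delta>(2) \<open>c > 0\<close> A_def hardy that in auto)
    have "h 0 \<le> 1 - (C - E) * r powr (4/3) + K * r\<^sup>2"
      unfolding K_def
      by (rule center_below_one[OF h \<open>\<tau> \<ge> 0\<close> _ \<epsilon>(1) \<open>\<epsilon> < 1\<close> C(1) \<open>E \<ge> 0\<close> \<nu>0 _ w])
        (use n r \<nu> E in \<open>auto simp: \<Lambda>_def\<close>)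
    also have "r\<^sup>2 = r powr (2/3) * r powr (4/3)" using r(1) by (simp flip: powr_add)
    also have "K * (r powr (2/3) * r powr (4/3)) \<le> (C - E) / 2 * r powr (4/3)"
      using mult_right_mono[OF less_imp_le[OF r(3)], of "r powr (4/3)"] by (simp add: mult.assoc)
    finally show "h 0 \<le> 1 - \<kappa>" unfolding \<kappa>_def by (simp add: algebra_simps diff_divide_distrib)
  qed
  then show ?thesis using \<open>\<kappa> > 0\<close> \<open>0 < \<nu>\<^sub>0\<close> \<open>\<nu>\<^sub>0 < \<nu>\<^sub>1\<close> by blast
qed

section \<open>Rotation invariance and reduction to radial functions\<close>

lemma partial_deriv_unique:
  "(f has_derivative f') (at x) \<Longrightarrow> partial_deriv i f x = f' (axis i 1)"
  unfolding partial_deriv_def by (simp add: frechet_derivative_at[symmetric])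

lemma partial_deriv_cong_open:
  assumes "f differentiable (at x)" "open X" "x \<in> X" "\<And>y. y \<in> X \<Longrightarrow> f y = g y"
  shows "partial_deriv i f x = partial_deriv i g x"
  unfolding partial_deriv_def using frechet_derivative_transform_within_open[OF assms] by simp

lemma differentiable_cong_open:
  assumes "f differentiable (at x)" "open X" "x \<in> X" "\<And>y. y \<in> X \<Longrightarrow> f y = g y"
  shows "g differentiable (at x)"
  using assms has_derivative_transform_within_open unfolding differentiable_def by metis

text \<open>Allows formulas for partial derivatives that are valid only inside \<Omega> to be
  substituted.\<close>

lemma Ck_up_to_boundary_cong:
  assumes "open \<Omega>" "Ck_up_to_boundary k \<Omega> f" "\<And>x. x \<in> \<Omega> \<Longrightarrow> f x = g x"
  shows "Ck_up_to_boundary k \<Omega> g"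
  using assms(2,3)
proof (induction k arbitrary: f g)
  case 0
  then show ?case by (simp add: extends_to_closure_def)
next
  case (Suc k)
  have d: "f differentiable (at x)" if "x \<in> \<Omega>" for x using Suc.prems that by simp
  have "Ck_up_to_boundary k \<Omega> (partial_deriv i g)" for i
    by (rule Suc.IH[of "partial_deriv i f"])
      (use Suc.prems partial_deriv_cong_open[OF d assms(1)] in auto)
  moreover have "g differentiable (at x)" if "x \<in> \<Omega>" for x
    by (rule differentiable_cong_open[OF d[OF that] assms(1) that]) (use Suc.prems in auto)
  ultimately show ?case using Suc.prems by (simp add: extends_to_closure_def)
qed

lemma differentiable_weighted_sum:
  fixes f :: "'j \<Rightarrow> 'a::real_normed_vector \<Rightarrow> real"
  assumes "finite J" "\<And>j. j \<in> J \<Longrightarrow> f j differentiable (at x)"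
  shows "(\<lambda>x. \<Sum>j\<in>J. a j * f j x) differentiable (at x)"
  using assms by (intro differentiable_sum differentiable_mult) auto

lemma partial_deriv_weighted_sum:
  assumes "finite J" "\<And>j. j \<in> J \<Longrightarrow> f j differentiable (at x)"
  shows "partial_deriv i (\<lambda>x. \<Sum>j\<in>J. a j * f j x) x = (\<Sum>j\<in>J. a j * partial_deriv i (f j) x)"
proof -
  have "((\<lambda>x. \<Sum>j\<in>J. a j * f j x) has_derivative
      (\<lambda>h. \<Sum>j\<in>J. a j * frechet_derivative (f j) (at x) h)) (at x)"
    using assms(2) by (intro has_derivative_sum has_derivative_mult_right) (simp add: frechet_derivative_works[symmetric])
  then show ?thesis by (simp add: partial_deriv_unique) (simp add: partial_deriv_def)
qed

lemma extends_to_closure_weighted_sum: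
  assumes "\<And>j. j \<in> J \<Longrightarrow> extends_to_closure \<Omega> (f j)"
  shows "extends_to_closure \<Omega> (\<lambda>x. \<Sum>j\<in>J. a j * f j x)"
proof -
  from assms obtain g where "\<And>j. j \<in> J \<Longrightarrow> continuous_on (closure \<Omega>) (g j) \<and> (\<forall>x\<in>\<Omega>. g j x = f j x)"
    unfolding extends_to_closure_def by metis
  then show ?thesis
    unfolding extends_to_closure_def
    by (intro exI[of _ "\<lambda>x. \<Sum>j\<in>J. a j * g j x"]) (auto intro!: continuous_intros sum.cong)
qed

text \<open>Serves both the Laplacian, with weights 1, and the chain rule for a rotation, with
  matrix entries as weights.\<close>

lemma Ck_up_to_boundary_weighted_sum:
  assumes "open \<Omega>" "finite J" "\<And>j. j \<in> J \<Longrightarrow> Ck_up_to_boundary k \<Omega> (f j)"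
  shows "Ck_up_to_boundary k \<Omega> (\<lambda>x. \<Sum>j\<in>J. a j * f j x)"
  using assms(3)
proof (induction k arbitrary: f)
  case 0
  then show ?case by (auto intro!: extends_to_closure_weighted_sum)
next
  case (Suc k)
  have d: "f j differentiable (at x)" if "x \<in> \<Omega>" "j \<in> J" for x j using Suc.prems[of j] that by simp
  have "Ck_up_to_boundary k \<Omega> (partial_deriv i (\<lambda>x. \<Sum>j\<in>J. a j * f j x))" for i
    by (rule Ck_up_to_boundary_cong[OF assms(1) Suc.IH[of "\<lambda>j. partial_deriv i (f j)"]])
      (use Suc.prems partial_deriv_weighted_sum[OF assms(2) d] in auto)
  then show ?case
    using Suc.prems by (auto intro!: extends_to_closure_weighted_sum differentiable_weighted_sum[OF assms(2) d])
qed

section \<open>Composition with orthogonal maps\<close>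

lemma orthogonal_ball_iff:
  fixes R :: "real^'n::finite \<Rightarrow> real^'n"
  assumes "orthogonal_transformation R"
  shows "R x \<in> ball 0 r \<longleftrightarrow> x \<in> ball 0 r" "R x \<in> sphere 0 r \<longleftrightarrow> x \<in> sphere 0 r" "R x \<in> cball 0 r \<longleftrightarrow> x \<in> cball 0 r"
  using orthogonal_transformation_norm[OF assms] by auto

lemma partial_deriv_compose_linear:
  fixes R :: "real^'n::finite \<Rightarrow> real^'n"
  assumes "linear R" "f differentiable (at (R x))"
  shows "partial_deriv i (\<lambda>x. f (R x)) x = (\<Sum>j\<in>UNIV. R (axis i 1) $ j * partial_deriv j f (R x))"
    and "(\<lambda>x. f (R x)) differentiable (at x)"
proof -
  let ?D = "frechet_derivative f (at (R x))"
  have D: "(f has_derivative ?D) (at (R x))" using assms(2) frechet_derivative_works by blast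
  then have lin: "linear ?D" using has_derivative_linear by blast
  have "(R has_derivative R) (at x)" by (rule linear_imp_has_derivative[OF assms(1)])
  then have *: "((\<lambda>x. f (R x)) has_derivative (\<lambda>h. ?D (R h))) (at x)"
    using has_derivative_compose D by blast
  then show "(\<lambda>x. f (R x)) differentiable (at x)" by (auto simp: differentiable_def)
  have "?D (R (axis i 1)) = ?D (\<Sum>j\<in>UNIV. (R (axis i 1) $ j) *\<^sub>R axis j 1)"
    using basis_expansion[of "R (axis i 1)"] by (simp add: scalar_mult_eq_scaleR)
  also have "\<dots> = (\<Sum>j\<in>UNIV. R (axis i 1) $ j * ?D (axis j 1))"
    using lin by (simp add: linear_sum linear_scale)
  finally show "partial_deriv i (\<lambda>x. f (R x)) x = (\<Sum>j\<in>UNIV. R (axis i 1) $ j * partial_deriv j f (R x))"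
    using partial_deriv_unique[OF *, of i] by (simp add: partial_deriv_def)
qed

lemma extends_to_closure_compose_orthogonal:
  fixes R :: "real^'n::finite \<Rightarrow> real^'n"
  assumes R: "orthogonal_transformation R" and f: "extends_to_closure (ball 0 1) f"
  shows "extends_to_closure (ball 0 1) (\<lambda>x. f (R x))"
proof -
  from f obtain g where g: "continuous_on (cball 0 1) g" "\<forall>x\<in>ball 0 1. g x = f x"
    unfolding extends_to_closure_def by auto
  have "continuous_on (cball 0 1) (\<lambda>x. g (R x))"
    by (rule continuous_on_compose2[OF g(1)])
      (use orthogonal_ball_iff[OF R] orthogonal_transformation_linear[OF R] in
        \<open>auto intro!: linear_continuous_on linear_conv_bounded_linear[THEN iffD1]\<close>)
  then show ?thesis
    unfolding extends_to_closure_def using g(2) orthogonal_ball_iff(1)[OF R, of _ 1]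
    by (intro exI[of _ "\<lambda>x. g (R x)"]) auto
qed

lemma Ck_up_to_boundary_compose_orthogonal:
  fixes R :: "real^'n::finite \<Rightarrow> real^'n"
  assumes R: "orthogonal_transformation R" and "Ck_up_to_boundary k (ball 0 1) f"
  shows "Ck_up_to_boundary k (ball 0 1) (\<lambda>x. f (R x))"
  using assms(2)
proof (induction k arbitrary: f)
  case 0
  then show ?case by (auto intro!: extends_to_closure_compose_orthogonal[OF R])
next
  case (Suc k)
  note lin = orthogonal_transformation_linear[OF R]
  have d: "f differentiable (at (R x))" if "x \<in> ball 0 1" for x
    using Suc.prems that orthogonal_ball_iff(1)[OF R, of x 1] by simp
  have "Ck_up_to_boundary k (ball 0 1) (partial_deriv i (\<lambda>x. f (R x)))" for i
  proof (rule Ck_up_to_boundary_cong[OF open_ball])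
    show "Ck_up_to_boundary k (ball 0 1) (\<lambda>x. \<Sum>j\<in>UNIV. R (axis i 1) $ j * partial_deriv j f (R x))"
      by (rule Ck_up_to_boundary_weighted_sum) (use Suc in auto)
  qed (use partial_deriv_compose_linear(1)[OF lin d] in auto)
  then show ?case
    using Suc.prems by (auto intro!: extends_to_closure_compose_orthogonal[OF R] partial_deriv_compose_linear(2)[OF lin d])
qed

lemma laplacian_cong_open:
  assumes "open \<Omega>" "Ck_up_to_boundary (Suc (Suc k)) \<Omega> f" "\<And>y. y \<in> \<Omega> \<Longrightarrow> f y = g y" "x \<in> \<Omega>"
  shows "laplacian f x = laplacian g x"
proof -
  have "partial_deriv i f y = partial_deriv i g y" if "y \<in> \<Omega>" for i y
    by (rule partial_deriv_cong_open[OF _ assms(1)]) (use assms that in auto)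
  then have "partial_deriv i (partial_deriv i f) x = partial_deriv i (partial_deriv i g) x" for i
    by (intro partial_deriv_cong_open[OF _ assms(1)]) (use assms in auto)
  then show ?thesis unfolding laplacian_def by simp
qed

lemma Ck_up_to_boundary_laplacian:
  assumes "open \<Omega>" "Ck_up_to_boundary (Suc (Suc k)) \<Omega> f"
  shows "Ck_up_to_boundary k \<Omega> (laplacian f)"
proof -
  have "Ck_up_to_boundary k \<Omega> (\<lambda>x. \<Sum>i\<in>UNIV. 1 * partial_deriv i (partial_deriv i f) x)"
    by (rule Ck_up_to_boundary_weighted_sum) (use assms in auto)
  then show ?thesis unfolding laplacian_def[abs_def] by simp
qed

text \<open>The chain rule applied twice gives a double sum over the Hessian, which orthogonality of
  the matrix M reduces to its trace.\<close>

lemma laplacian_compose_orthogonal: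
  fixes R :: "real^'n::finite \<Rightarrow> real^'n"
  assumes R: "orthogonal_transformation R" and f: "Ck_up_to_boundary (Suc (Suc k)) (ball 0 1) f"
    and x: "x \<in> ball 0 1"
  shows "laplacian (\<lambda>x. f (R x)) x = laplacian f (R x)"
proof -
  note lin = orthogonal_transformation_linear[OF R]
  have ball: "R y \<in> ball 0 1" if "y \<in> ball 0 1" for y
    using that orthogonal_ball_iff(1)[OF R, of y 1] by simp
  have d: "f differentiable (at (R y))" if "y \<in> ball 0 1" for y using f ball[OF that] by simp
  have d1: "partial_deriv j f differentiable (at (R y))" if "y \<in> ball 0 1" for y j
    using f ball[OF that] by simp
  define M where "M i j = R (axis i 1) $ j" for i j
  \<comment> \<open>The transpose of M belongs to the inverse of R, which is orthogonal too.\<close>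
  have ortho: "(\<Sum>i\<in>UNIV. M i j * M i k) = (if j = k then 1 else 0)" for j k
  proof -
    have M: "M i j = inv R (axis j 1) $ i" for i j
    proof -
      have "M i j = R (axis i 1) \<bullet> R (inv R (axis j 1))"
        unfolding M_def using orthogonal_transformation_surj[OF R]
        by (simp add: surj_f_inv_f cart_eq_inner_axis)
      also have "\<dots> = inv R (axis j 1) $ i"
        using R by (simp add: orthogonal_transformation_def cart_eq_inner_axis inner_commute)
      finally show ?thesis .
    qed
    have "(\<Sum>i\<in>UNIV. M i j * M i k) = inv R (axis j 1) \<bullet> inv R (axis k 1)"
      unfolding M by (simp add: inner_vec_def)
    also have "\<dots> = axis j 1 \<bullet> (axis k 1 :: real^'n)"
      using orthogonal_transformation_inv[OF R] by (simp add: orthogonal_transformation_def)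
    finally show ?thesis by (simp add: inner_axis_axis)
  qed
  have "partial_deriv i (partial_deriv i (\<lambda>x. f (R x))) x
      = (\<Sum>j\<in>UNIV. M i j * (\<Sum>k\<in>UNIV. M i k * partial_deriv k (partial_deriv j f) (R x)))" for i
  proof -
    have e: "partial_deriv i (\<lambda>x. f (R x)) y = (\<Sum>j\<in>UNIV. M i j * partial_deriv j f (R y))"
      if "y \<in> ball 0 1" for y
      unfolding M_def by (rule partial_deriv_compose_linear(1)[OF lin d[OF that]])
    have dd: "(\<lambda>y. \<Sum>j\<in>UNIV. M i j * partial_deriv j f (R y)) differentiable (at x)"
      by (rule differentiable_weighted_sum) (use partial_deriv_compose_linear(2)[OF lin d1[OF x]] in auto)
    have "partial_deriv i (partial_deriv i (\<lambda>x. f (R x))) x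
        = partial_deriv i (\<lambda>y. \<Sum>j\<in>UNIV. M i j * partial_deriv j f (R y)) x"
      by (rule partial_deriv_cong_open[OF dd open_ball x, symmetric]) (use e in auto)
    also have "\<dots> = (\<Sum>j\<in>UNIV. M i j * partial_deriv i (\<lambda>y. partial_deriv j f (R y)) x)"
      by (rule partial_deriv_weighted_sum) (use partial_deriv_compose_linear(2)[OF lin d1[OF x]] in auto)
    finally show ?thesis
      unfolding M_def using partial_deriv_compose_linear(1)[OF lin d1[OF x]] by simp
  qed
  then have "laplacian (\<lambda>x. f (R x)) x
      = (\<Sum>i\<in>UNIV. \<Sum>j\<in>UNIV. \<Sum>k\<in>UNIV. M i j * M i k * partial_deriv k (partial_deriv j f) (R x))"
    unfolding laplacian_def by (simp add: sum_distrib_left mult.assoc)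
  also have "\<dots> = (\<Sum>j\<in>UNIV. \<Sum>k\<in>UNIV. (\<Sum>i\<in>UNIV. M i j * M i k) * partial_deriv k (partial_deriv j f) (R x))"
    by (subst sum.swap, rule sum.cong[OF refl], subst sum.swap) (simp add: sum_distrib_right)
  also have "\<dots> = laplacian f (R x)"
    unfolding ortho laplacian_def by (simp add: if_distrib[of "\<lambda>x. x * _"] cong: if_cong)
  finally show ?thesis .
qed

lemma classical_solution_compose_orthogonal:
  fixes R :: "real^'n::finite \<Rightarrow> real^'n"
  assumes R: "orthogonal_transformation R" and u: "classical_solution \<beta> \<tau> \<mu> u"
  shows "classical_solution \<beta> \<tau> \<mu> (\<lambda>x. u (R x))"
proof -
  note lin = orthogonal_transformation_linear[OF R]
  have cont: "continuous_on A R" for A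
    by (rule linear_continuous_on) (use lin linear_conv_bounded_linear in blast)
  have C4: "Ck_up_to_boundary 4 (ball 0 1) u" and cu: "continuous_on (cball 0 1) u"
    using u by (auto simp: classical_solution_def Ck_closure_def)
  have C4': "Ck_up_to_boundary (Suc (Suc (Suc (Suc 0)))) (ball 0 1) u"
    using C4 by (simp add: numeral_eq_Suc)
  note C2 = Ck_up_to_boundary_laplacian[OF open_ball C4']
  have "Ck_up_to_boundary 4 (ball 0 1) (\<lambda>x. u (R x))"
    by (rule Ck_up_to_boundary_compose_orthogonal[OF R C4])
  moreover have "continuous_on (cball 0 1) (\<lambda>x. u (R x))"
    by (rule continuous_on_compose2[OF cu cont]) (use orthogonal_ball_iff[OF R] in auto)
  ultimately have 1: "Ck_closure 4 (ball 0 1) (\<lambda>x. u (R x))"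
    by (simp add: Ck_closure_def)
  have "(\<lambda>x. u (R x)) ` ball 0 1 = u ` (R ` ball 0 1)" by (simp add: image_image)
  also have "R ` ball 0 1 = ball 0 1"
    using image_orthogonal_transformation_ball[OF R, of 0 1] linear_0[OF lin] by simp
  finally have 2: "(SUP x\<in>ball 0 1. u (R x)) < 1" using u by (simp add: classical_solution_def)
  have lap: "laplacian (\<lambda>x. u (R x)) x = laplacian u (R x)" if "x \<in> ball 0 1" for x
    by (rule laplacian_compose_orthogonal[OF R C4' that])
  have lap2: "laplacian (laplacian (\<lambda>x. u (R x))) x = laplacian (laplacian u) (R x)"
    if x: "x \<in> ball 0 1" for x
  proof -
    have "laplacian (laplacian (\<lambda>x. u (R x))) x = laplacian (\<lambda>x. laplacian u (R x)) x"
      by (rule laplacian_cong_open[OF open_ball Ck_up_to_boundary_compose_orthogonal[OF R C2], symmetric])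
        (use lap x in auto)
    then show ?thesis using laplacian_compose_orthogonal[OF R C2 x] by simp
  qed
  have 3: "(laplacian (\<lambda>x. u (R x)) \<longlongrightarrow> 0) (at x within ball 0 1)" if x: "x \<in> sphere 0 1" for x
  proof -
    have "(laplacian u \<longlongrightarrow> 0) (at (R x) within ball 0 1)"
      using u x orthogonal_ball_iff(2)[OF R, of x 1] by (auto simp: classical_solution_def)
    moreover have "filterlim R (at (R x) within ball 0 1) (at x within ball 0 1)"
      unfolding filterlim_at
    proof
      show "(R \<longlongrightarrow> R x) (at x within ball 0 1)"
        using cont[of UNIV] by (auto simp: continuous_on_def intro: tendsto_within_subset)
      have "eventually (\<lambda>y. y \<in> ball 0 1 \<and> y \<noteq> x) (at x within ball 0 1)"
        by (simp add: eventually_at_filter)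
      then show "\<forall>\<^sub>F y in at x within ball 0 1. R y \<in> ball 0 1 \<and> R y \<noteq> R x"
        by eventually_elim
          (use orthogonal_ball_iff(1)[OF R, of _ 1] orthogonal_transformation_inj[OF R] in \<open>auto simp: inj_def\<close>)
    qed
    ultimately have "((\<lambda>y. laplacian u (R y)) \<longlongrightarrow> 0) (at x within ball 0 1)"
      by (rule filterlim_compose)
    moreover have "eventually (\<lambda>y. laplacian u (R y) = laplacian (\<lambda>x. u (R x)) y) (at x within ball 0 1)"
      using lap by (simp add: eventually_at_filter)
    ultimately show ?thesis by (rule Lim_transform_eventually)
  qed
  show ?thesis
    unfolding classical_solution_def
    using 1 2 3 u orthogonal_ball_iff[OF R, of _ 1]
    by (auto simp: lap lap2 classical_solution_def)
qed

text \<open>For an orthogonal R with R a = b, u composed with R is again a solution, so minimality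
  gives u a \<le> u b; the roles of a and b can be exchanged.\<close>

lemma minimal_solution_radial:
  fixes u :: "real^'n::finite \<Rightarrow> real"
  assumes u: "minimal_solution \<beta> \<tau> \<mu> u" and "x \<in> ball 0 1" "norm x = norm y"
  shows "u x = u y"
proof -
  have le: "u a \<le> u b" if "a \<in> ball 0 1" "norm a = norm b" for a b
  proof -
    obtain R where R: "orthogonal_transformation R" "R a = b"
      using orthogonal_transformation_exists[OF \<open>norm a = norm b\<close>] .
    have "classical_solution \<beta> \<tau> \<mu> (\<lambda>x. u (R x))"
      using classical_solution_compose_orthogonal[OF R(1)] u by (simp add: minimal_solution_def)
    then show ?thesis using u that R(2) unfolding minimal_solution_def by metis
  qed
  show ?thesis using assms(2,3) by (intro antisym le) auto
qed

section \<open>Radial functions and the Laplacian in polar coordinates\<close>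

lemma DERIV_along_line:
  fixes f :: "real^'n::finite \<Rightarrow> real"
  assumes "f differentiable (at (a + t *\<^sub>R axis i 1))"
  shows "((\<lambda>s. f (a + s *\<^sub>R axis i 1)) has_real_derivative partial_deriv i f (a + t *\<^sub>R axis i 1)) (at t)"
proof -
  let ?D = "frechet_derivative f (at (a + t *\<^sub>R axis i 1))"
  have D: "(f has_derivative ?D) (at (a + t *\<^sub>R axis i 1))" using assms frechet_derivative_works by blast
  have "((\<lambda>s. a + s *\<^sub>R axis i 1) has_derivative (\<lambda>h. h *\<^sub>R axis i 1)) (at t)"
    by (auto intro!: derivative_eq_intros)
  from has_derivative_compose[OF this D]
  have "((\<lambda>s. f (a + s *\<^sub>R axis i 1)) has_derivative (\<lambda>h. ?D (h *\<^sub>R axis i 1))) (at t)" .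
  moreover have "?D (h *\<^sub>R axis i 1) = partial_deriv i f (a + t *\<^sub>R axis i 1) * h" for h
    using linear_scale[OF has_derivative_linear[OF D], of h] by (simp add: partial_deriv_def)
  ultimately show ?thesis by (simp add: has_field_derivative_def fun_eq_iff[symmetric])
qed

lemma DERIV_along_axis:
  fixes f :: "real^'n::finite \<Rightarrow> real"
  assumes "f differentiable (at (t *\<^sub>R axis i 1))"
  shows "((\<lambda>s. f (s *\<^sub>R axis i 1)) has_real_derivative partial_deriv i f (t *\<^sub>R axis i 1)) (at t)"
  using DERIV_along_line[of f 0 t i] assms by simp

lemma partial_deriv_radial:
  fixes f :: "real^'n::finite \<Rightarrow> real"
  assumes diff: "\<And>x. x \<in> ball 0 1 \<Longrightarrow> f differentiable (at x)"
    and radial: "\<And>x y. x \<in> ball 0 1 \<Longrightarrow> norm x = norm y \<Longrightarrow> f x = f y"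
    and x: "x \<in> ball 0 1" "x \<noteq> 0"
  shows "partial_deriv i f x = partial_deriv k f (norm x *\<^sub>R axis k 1) * (x $ i / norm x)"
proof -
  let ?d = "partial_deriv k f (norm x *\<^sub>R axis k 1)"
  have 1: "((\<lambda>s. f (s *\<^sub>R axis k 1)) has_derivative (\<lambda>h. ?d * h)) (at (norm x))"
    using DERIV_along_axis[of f "norm x" k] diff[of "norm x *\<^sub>R axis k 1"] x
    by (simp add: has_field_derivative_def)
  have "((\<lambda>y. f (norm y *\<^sub>R axis k 1)) has_derivative (\<lambda>h. ?d * (h \<bullet> sgn x))) (at x)"
    by (rule has_derivative_compose[OF has_derivative_norm[OF x(2)] 1])
  then have "(f has_derivative (\<lambda>h. ?d * (h \<bullet> sgn x))) (at x)"
    by (rule has_derivative_transform_within_open[OF _ open_ball x(1)]) (rule radial[symmetric], auto)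
  from partial_deriv_unique[OF this, of i] show ?thesis
    by (simp add: sgn_div_norm inner_axis inner_commute divide_inverse)
qed

lemma laplacian_radial:
  fixes f :: "real^'n::finite \<Rightarrow> real" and k :: 'n
  assumes diff: "\<And>x. x \<in> ball 0 1 \<Longrightarrow> f differentiable (at x)"
    and diff2: "\<And>x j. x \<in> ball 0 1 \<Longrightarrow> partial_deriv j f differentiable (at x)"
    and radial: "\<And>x y. x \<in> ball 0 1 \<Longrightarrow> norm x = norm y \<Longrightarrow> f x = f y"
    and r: "0 < r" "r < 1"
  defines "d \<equiv> \<lambda>s. partial_deriv k f (s *\<^sub>R axis k 1)"
  shows "(d has_real_derivative laplacian f (r *\<^sub>R axis k 1) - (real CARD('n) - 1) / r * d r) (at r)"
proof -
  let ?e = "r *\<^sub>R axis k 1 :: real^'n"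
  have d': "(d has_real_derivative partial_deriv k (partial_deriv k f) (s *\<^sub>R axis k 1)) (at s)"
    if "\<bar>s\<bar> < 1" for s
    unfolding d_def using that by (intro DERIV_along_axis diff2) simp
  \<comment> \<open>Along the line through r e_k in direction e_i, the i-th partial derivative is t
    d (N t) / N t. The factor multiplying t is continuous, so the derivative at t = 0 is its value d
    r / r.\<close>
  have trans: "partial_deriv i (partial_deriv i f) ?e = d r / r" if "i \<noteq> k" for i
  proof -
    define N where "N t = norm (?e + t *\<^sub>R axis i 1)" for t :: real
    have "isCont N 0" unfolding N_def by (intro continuous_intros)
    have N0: "N 0 = r" unfolding N_def using r by simp
    have "isCont d r" using d'[of r] r DERIV_isCont by force
    then have "isCont (\<lambda>t. d (N t)) 0"
      using isCont_o2[OF \<open>isCont N 0\<close>, of d] N0 by simp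
    then have cont: "isCont (\<lambda>t. d (N t) / N t) 0"
      using \<open>isCont N 0\<close> N0 r by (intro continuous_divide) auto
    have "((\<lambda>t. t * (d (N t) / N t)) has_real_derivative d (N 0) / N 0) (at 0)"
      by (rule CARAT_DERIV[THEN iffD2], rule exI[of _ "\<lambda>t. d (N t) / N t"]) (use cont in auto)
    then have 1: "((\<lambda>t. t * (d (N t) / N t)) has_real_derivative d r / r) (at 0)" by (simp only: N0)
    have 2: "((\<lambda>t. partial_deriv i f (?e + t *\<^sub>R axis i 1)) has_real_derivative d r / r) (at 0)"
    proof (rule has_field_derivative_transform_within_open[OF 1, of "{-(1 - r)<..<1 - r}"])
      fix t assume t: "t \<in> {-(1 - r)<..<1 - r}"
      have "N t \<le> r + \<bar>t\<bar>" unfolding N_def using norm_triangle_ineq[of ?e "t *\<^sub>R axis i 1"] r by simp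
      then have "?e + t *\<^sub>R axis i 1 \<in> ball 0 1" using t unfolding N_def by auto
      moreover have "?e + t *\<^sub>R axis i 1 \<noteq> 0"
      proof
        assume "?e + t *\<^sub>R axis i 1 = 0"
        then have "(?e + t *\<^sub>R axis i 1) $ k = 0" by simp
        then show False using r that by (simp add: axis_def)
      qed
      ultimately have "partial_deriv i f (?e + t *\<^sub>R axis i 1)
          = d (N t) * ((?e + t *\<^sub>R axis i 1) $ i / N t)"
        unfolding d_def N_def by (intro partial_deriv_radial[OF diff radial])
      then show "t * (d (N t) / N t) = partial_deriv i f (?e + t *\<^sub>R axis i 1)"
        using that by (simp add: axis_def)
    qed (use r in auto)
    have "((\<lambda>t. partial_deriv i f (?e + t *\<^sub>R axis i 1)) has_real_derivative
        partial_deriv i (partial_deriv i f) (?e + 0 *\<^sub>R axis i 1)) (at 0)"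
      by (intro DERIV_along_line diff2) (use r in simp)
    from DERIV_unique[OF this 2] show ?thesis by simp
  qed
  have "laplacian f ?e = partial_deriv k (partial_deriv k f) ?e + (\<Sum>i\<in>UNIV - {k}. d r / r)"
    unfolding laplacian_def by (subst sum.remove[of _ k]) (auto simp: trans)
  then have "partial_deriv k (partial_deriv k f) ?e = laplacian f ?e - (real CARD('n) - 1) / r * d r"
    by (simp add: of_nat_diff)
  then show ?thesis using d'[of r] r by simp
qed

text \<open>A real supremum is an upper bound only of a bounded set; continuity on the closed ball
  provides boundedness.\<close>

lemma classical_solution_less_one:
  fixes u :: "real^'n::finite \<Rightarrow> real"
  assumes u: "classical_solution \<beta> \<tau> \<mu> u" and x: "x \<in> ball 0 1"
  shows "u x < 1"
proof -
  have "continuous_on (cball 0 1) u" using u by (simp add: classical_solution_def Ck_closure_def)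
  then have "bounded (u ` cball 0 1)"
    by (intro compact_imp_bounded compact_continuous_image) auto
  then have "bdd_above (u ` ball 0 1)"
    by (intro bounded_imp_bdd_above) (rule bounded_subset, auto)
  then have "u x \<le> (SUP x\<in>ball 0 1. u x)" using x by (intro cSUP_upper)
  then show ?thesis using u by (simp add: classical_solution_def)
qed

text \<open>Restriction to a coordinate ray, with n = N - 1 and z = - \<Delta> u, after dividing the
  equation by \<beta>.\<close>

lemma minimal_solution_is_radial_solution:
  fixes u :: "real^'n::finite \<Rightarrow> real"
  assumes u: "minimal_solution \<beta> \<tau> \<mu> u" and "\<beta> > 0" and N: "CARD('n) \<ge> 2"
  shows "\<exists>h h1 z z1. radial_solution (CARD('n) - 1) (\<tau> / \<beta>) (\<mu> / \<beta>) h h1 z z1 \<and>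
    (\<forall>x\<in>ball 0 1. u x = h (norm x))"
proof -
  define n where "n = CARD('n) - 1"
  define k :: 'n where "k = undefined"
  define e :: "real^'n" where "e = axis k 1"
  have cl: "classical_solution \<beta> \<tau> \<mu> u" using u by (simp add: minimal_solution_def)
  have C4: "Ck_up_to_boundary (Suc (Suc (Suc (Suc 0)))) (ball 0 1) u"
    using cl by (simp add: classical_solution_def Ck_closure_def numeral_eq_Suc)
  let ?v = "laplacian u"
  have C2: "Ck_up_to_boundary (Suc (Suc 0)) (ball 0 1) ?v"
    by (rule Ck_up_to_boundary_laplacian[OF open_ball C4])
  have du: "u differentiable (at x)" "partial_deriv j u differentiable (at x)"
    "?v differentiable (at x)" "partial_deriv j ?v differentiable (at x)" if "x \<in> ball 0 1" for x j
    using C4 C2 that by auto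
  note rad = minimal_solution_radial[OF u]
  \<comment> \<open>The Laplacian inherits radiality from u, so the polar formula can be applied to
    it a second time.\<close>
  have radv: "?v x = ?v y" if x: "x \<in> ball 0 1" "norm x = norm y" for x y
  proof -
    obtain R where R: "orthogonal_transformation R" "R x = y"
      using orthogonal_transformation_exists[OF \<open>norm x = norm y\<close>] .
    have "?v x = laplacian (\<lambda>x. u (R x)) x"
      by (rule laplacian_cong_open[OF open_ball C4 _ x(1)])
        (rule rad, simp_all add: orthogonal_transformation_norm[OF R(1)])
    also have "\<dots> = ?v y" using laplacian_compose_orthogonal[OF R(1) C4 x(1)] R(2) by simp
    finally show ?thesis .
  qed
  define h where "h r = u (r *\<^sub>R e)" for r
  define h1 where "h1 r = partial_deriv k u (r *\<^sub>R e)" for r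
  define z where "z r = - ?v (r *\<^sub>R e)" for r
  define z1 where "z1 r = - partial_deriv k ?v (r *\<^sub>R e)" for r
  have ne: "norm e = 1" "e \<noteq> 0" unfolding e_def by (simp_all add: axis_eq_0_iff)
  have n: "real n = real CARD('n) - 1" unfolding n_def using N by (simp add: of_nat_diff)
  have cu: "continuous_on (cball 0 1) u" using cl by (simp add: classical_solution_def Ck_closure_def)
  have ch: "continuous_on {0..1} h"
    unfolding h_def by (rule continuous_on_compose2[OF cu]) (auto intro!: continuous_intros simp: ne)
  have h_1: "h 1 = 0" using cl ne unfolding h_def by (simp add: classical_solution_def)
  have h_01: "0 < h r \<and> h r < 1" if "0 \<le> r" "r < 1" for r
    using classical_solution_less_one[OF cl, of "r *\<^sub>R e"] cl that ne
    unfolding h_def by (auto simp: classical_solution_def)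
  have u_h: "u x = h (norm x)" if "x \<in> ball 0 1" for x
    unfolding h_def using that by (intro rad) (auto simp: ne)
  have z_1: "(z \<longlongrightarrow> 0) (at_left 1)"
  proof -
    have "(?v \<longlongrightarrow> 0) (at e within ball 0 1)" using cl ne by (simp add: classical_solution_def)
    moreover have "filterlim (\<lambda>r. r *\<^sub>R e) (at e within ball 0 1) (at_left 1)"
      unfolding filterlim_at
    proof
      have "((\<lambda>r. r *\<^sub>R e) \<longlongrightarrow> 1 *\<^sub>R e) (at_left 1)" by (intro tendsto_intros)
      then show "((\<lambda>r. r *\<^sub>R e) \<longlongrightarrow> e) (at_left 1)" by simp
      have "r *\<^sub>R e \<in> ball 0 1 \<and> r *\<^sub>R e \<noteq> e" if "0 < r" "r < 1" for r
      proof
        show "r *\<^sub>R e \<in> ball 0 1" using that ne by simp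
        then show "r *\<^sub>R e \<noteq> e" using ne by (metis mem_ball_0 less_irrefl)
      qed
      then show "\<forall>\<^sub>F r in at_left 1. r *\<^sub>R e \<in> ball 0 1 \<and> r *\<^sub>R e \<noteq> e"
        unfolding eventually_at_left_field by (intro exI[of _ 0]) auto
    qed
    ultimately have "((\<lambda>r. ?v (r *\<^sub>R e)) \<longlongrightarrow> 0) (at_left 1)" by (rule filterlim_compose)
    from tendsto_minus[OF this] show ?thesis unfolding z_def[abs_def] by simp
  qed
  \<comment> \<open>For n \<ge> 1 continuity at the origin suffices; N \<ge> 2 ensures this.\<close>
  have flux: "((\<lambda>r. r ^ n * F r) \<longlongrightarrow> 0) (at_right 0)" if "isCont F 0" for F :: "real \<Rightarrow> real"
  proof -
    have "isCont (\<lambda>r. r ^ n * F r) 0" using that by (intro continuous_intros)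
    then have "((\<lambda>r. r ^ n * F r) \<longlongrightarrow> 0 ^ n * F 0) (at 0)" by (simp add: isCont_def)
    then show ?thesis using N by (simp add: n_def power_0_left filterlim_at_split)
  qed
  have c: "isCont h1 0" "isCont z1 0"
  proof -
    have "isCont (partial_deriv k u) (0 *\<^sub>R e)" "isCont (partial_deriv k ?v) (0 *\<^sub>R e)"
      using du(2,4)[of 0] by (auto intro!: differentiable_imp_continuous_within)
    moreover have "isCont (\<lambda>r. r *\<^sub>R e) 0" by (intro continuous_intros)
    ultimately show "isCont h1 0" "isCont z1 0"
      unfolding h1_def z1_def
      using isCont_o2[of "0::real" "\<lambda>r. r *\<^sub>R e"] by (blast, blast intro: continuous_minus)
  qed
  have sys: "radial_system n (\<tau> / \<beta>) h h1 z z1 (\<lambda>r. (\<mu> / \<beta>) / (1 - h r)\<^sup>2)"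
    unfolding radial_system_def
  proof (intro conjI ballI flux c)
    show "continuous_on {0..<1} h" by (rule continuous_on_subset[OF ch]) auto
    fix r :: real assume r: "r \<in> {0<..<1}"
    then have b: "r *\<^sub>R e \<in> ball 0 1" by (simp add: ne)
    show "(h has_real_derivative h1 r) (at r)"
      unfolding h_def h1_def e_def by (rule DERIV_along_axis) (use du b in \<open>auto simp: e_def\<close>)
    have "((\<lambda>s. ?v (s *\<^sub>R axis k 1)) has_real_derivative partial_deriv k ?v (r *\<^sub>R axis k 1)) (at r)"
      by (rule DERIV_along_axis) (use du b in \<open>auto simp: e_def\<close>)
    then show "(z has_real_derivative z1 r) (at r)"
      unfolding z_def z1_def e_def by (rule DERIV_minus)
    show "(h1 has_real_derivative - (n / r) * h1 r - z r) (at r)"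
      using laplacian_radial[OF du(1) du(2) rad, of r k] r
      unfolding h1_def z_def e_def n by simp
    have "\<beta> * laplacian ?v (r *\<^sub>R e) - \<tau> * ?v (r *\<^sub>R e) = \<mu> / (1 - h r)\<^sup>2"
      using cl b unfolding h_def by (simp add: classical_solution_def)
    then have "laplacian ?v (r *\<^sub>R e) = \<tau> / \<beta> * ?v (r *\<^sub>R e) + (\<mu> / \<beta>) / (1 - h r)\<^sup>2"
      using \<open>\<beta> > 0\<close> by (simp add: field_simps)
    then have "- (laplacian ?v (r *\<^sub>R e) - (real CARD('n) - 1) / r * partial_deriv k ?v (r *\<^sub>R e))
      = - (n / r) * z1 r + \<tau> / \<beta> * z r - (\<mu> / \<beta>) / (1 - h r)\<^sup>2"
      unfolding z1_def z_def n by (simp add: algebra_simps)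
    moreover have "((\<lambda>r. - partial_deriv k ?v (r *\<^sub>R e)) has_real_derivative
      - (laplacian ?v (r *\<^sub>R e) - (real CARD('n) - 1) / r * partial_deriv k ?v (r *\<^sub>R e))) (at r)"
      using laplacian_radial[OF du(3) du(4) radv, of r k] r
      unfolding e_def by (intro DERIV_minus) simp
    ultimately show "(z1 has_real_derivative - (n / r) * z1 r + \<tau> / \<beta> * z r - (\<mu> / \<beta>) / (1 - h r)\<^sup>2) (at r)"
      unfolding z1_def[abs_def] by simp
  qed
  have "radial_solution n (\<tau> / \<beta>) (\<mu> / \<beta>) h h1 z z1"
    unfolding radial_solution_def using sys z_1 ch h_1 h_01 by auto
  then show ?thesis unfolding n_def using u_h by blast
qed

section \<open>Passage to the limit along the minimal branch\<close>

theorem theorem4p3: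
  fixes ustar :: "real^'n::finite \<Rightarrow> real" and \<beta> \<tau> :: real
  assumes "5 \<le> CARD('n)" and "CARD('n) \<le> 8"
    and "\<beta> > 0" and "\<tau> > 0"
    and "extremal_solution \<beta> \<tau> ustar"
  shows "regular ustar"
proof -
  define L where "L = lambda_star TYPE('n) \<beta> \<tau>"
  define n where "n = CARD('n) - 1"
  obtain U :: "real \<Rightarrow> real^'n \<Rightarrow> real" where
    U: "\<And>\<mu>. \<mu> \<in> {0<..<L} \<Longrightarrow> minimal_solution \<beta> \<tau> \<mu> (U \<mu>)"
    and mono: "\<And>x. x \<in> ball 0 1 \<Longrightarrow> mono_on {0<..<L} (\<lambda>\<mu>. U \<mu> x)"
    and lim: "\<And>x. x \<in> ball 0 1 \<Longrightarrow> ((\<lambda>\<mu>. U \<mu> x) \<longlongrightarrow> ustar x) (at_left L)"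
    and ne: "solvable_params TYPE('n) \<beta> \<tau> \<noteq> {}" and bdd: "bdd_above (solvable_params TYPE('n) \<beta> \<tau>)"
    using assms(5) unfolding extremal_solution_def L_def by blast
  from ne obtain \<mu> where \<mu>: "\<mu> \<in> solvable_params TYPE('n) \<beta> \<tau>" by blast
  then have "\<mu> \<le> L" unfolding L_def lambda_star_def using bdd by (rule cSup_upper)
  then have "L > 0" using \<mu> by (auto simp: solvable_params_def)
  have n: "4 \<le> n" "n \<le> 7" and N2: "CARD('n) \<ge> 2" using assms(1,2) by (auto simp: n_def)
  have pos: "\<tau> / \<beta> \<ge> 0" "L / \<beta> > 0" using assms \<open>L > 0\<close> by auto
  obtain \<kappa> \<nu>\<^sub>0 where
    \<kappa>: "\<kappa> > 0" and \<nu>\<^sub>0: "0 < \<nu>\<^sub>0" "\<nu>\<^sub>0 < L / \<beta>" and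
    bound: "\<forall>\<nu> \<nu>' h h1 z z1 k k1 y y1.
      \<nu>\<^sub>0 < \<nu> \<and> \<nu> < \<nu>' \<and> \<nu>' < L / \<beta> \<and>
      radial_solution n (\<tau> / \<beta>) \<nu> h h1 z z1 \<and> radial_solution n (\<tau> / \<beta>) \<nu>' k k1 y y1 \<and>
      (\<forall>r. 0 \<le> r \<and> r < 1 \<longrightarrow> h r \<le> k r) \<longrightarrow> h 0 \<le> 1 - \<kappa>"
    using radial_solutions_uniformly_below_one[OF n pos] by blast
  have radial: "\<exists>h h1 z z1. radial_solution n (\<tau> / \<beta>) (\<mu> / \<beta>) h h1 z z1 \<and> (\<forall>x\<in>ball 0 1. U \<mu> x = h (norm x))"
    if \<mu>: "\<mu> \<in> {0<..<L}" for \<mu>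
    using minimal_solution_is_radial_solution[OF U[OF \<mu>] \<open>\<beta> > 0\<close> N2] unfolding n_def .
  have below: "U \<mu> x \<le> 1 - \<kappa>" if \<mu>: "\<beta> * \<nu>\<^sub>0 < \<mu>" "\<mu> < L" and x: "x \<in> ball 0 1" for \<mu> x
  proof -
    \<comment> \<open>Any larger parameter below the extremal one provides the second solution that
      witnesses stability.\<close>
    define \<mu>' where "\<mu>' = (\<mu> + L) / 2"
    have "\<beta> * \<nu>\<^sub>0 > 0" using \<nu>\<^sub>0 \<open>\<beta> > 0\<close> by simp
    then have range: "\<mu> \<in> {0<..<L}" "\<mu>' \<in> {0<..<L}" "\<mu> < \<mu>'" using \<mu> unfolding \<mu>'_def by auto
    obtain h h1 z z1 where h: "radial_solution n (\<tau> / \<beta>) (\<mu> / \<beta>) h h1 z z1"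
      "\<And>x. x \<in> ball 0 1 \<Longrightarrow> U \<mu> x = h (norm x)" using radial[OF range(1)] by blast
    obtain k k1 y y1 where k: "radial_solution n (\<tau> / \<beta>) (\<mu>' / \<beta>) k k1 y y1"
      "\<And>x. x \<in> ball 0 1 \<Longrightarrow> U \<mu>' x = k (norm x)" using radial[OF range(2)] by blast
    have le: "h r \<le> k r" if "0 \<le> r" "r < 1" for r
    proof -
      have r: "r *\<^sub>R axis undefined 1 \<in> ball (0 :: real^'n) 1" "norm (r *\<^sub>R axis undefined 1 :: real^'n) = r"
        using that by auto
      have "U \<mu> (r *\<^sub>R axis undefined 1) \<le> U \<mu>' (r *\<^sub>R axis undefined 1)"
        using mono[OF r(1)] range by (auto simp: mono_on_def)
      then show ?thesis unfolding h(2)[OF r(1)] k(2)[OF r(1)] r(2) .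
    qed
    have "\<nu>\<^sub>0 < \<mu> / \<beta>" "\<mu> / \<beta> < \<mu>' / \<beta>" "\<mu>' / \<beta> < L / \<beta>"
      using \<mu> range \<open>\<beta> > 0\<close> by (auto simp: field_simps)
    then have "h 0 \<le> 1 - \<kappa>" using bound h(1) k(1) le by blast
    moreover have "h (norm x) \<le> h 0"
      by (rule radial_solution_le_center[OF h(1)]) (use assms range x in auto)
    ultimately show ?thesis using h(2)[OF x] by simp
  qed
  \<comment> \<open>The bound is uniform for all parameters close to L, so it survives the
    limit.\<close>
  have "ustar x \<le> 1 - \<kappa>" if x: "x \<in> ball 0 1" for x
  proof (rule tendsto_upperbound[OF lim[OF x]])
    have "\<beta> * \<nu>\<^sub>0 < L" using \<nu>\<^sub>0 \<open>\<beta> > 0\<close> by (simp add: field_simps)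
    then show "\<forall>\<^sub>F \<mu> in at_left L. U \<mu> x \<le> 1 - \<kappa>"
      unfolding eventually_at_left_field using below x by blast
  qed simp
  then have "(SUP x\<in>ball 0 1. ustar x) \<le> 1 - \<kappa>" by (intro cSUP_least) auto
  then show ?thesis using \<kappa> unfolding regular_def by simp
qed

end
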